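(* Let $\mathcal X$ be a Polish space and $\mu\in\mathcal P(\mathcal X)$. Let $\mathcal F$ be a vector space of measurable functions $\mathcal X\to\mathbb R$ such that $\int_{\mathcal X}e^{\varphi}\,d\mu<\infty$ for all $\varphi\in\mathcal F$, and let $\Phi$ be a set of couples $(\psi,\varphi)$ of continuous functions with $(0,0)\in\Phi\subset\mathcal F\times\mathcal F$. Then: (a) any deviation function for $\mathcal T$ is a transportation function for $\mathcal T$ in $\mathcal P_{\mathcal F}$; (b) if in addition $\mathcal T$ is continuous on $\mathcal P_{\mathcal F}$, then the converse also holds: any transportation function for $\mathcal T$ in $\mathcal P_{\mathcal F}$ is a deviation function for $\mathcal T$.
   Context: $\mathcal P(\mathcal X)$ is the set of Borel probability measures on $\mathcal X$. $H(\nu\mid\mu)=\int\log\frac{d\nu}{d\mu}\,d\nu$ if $\nu\ll\mu$ and $+\infty$ otherwise. $\mathcal P_{\mathcal F}=\{\nu\in\mathcal P(\mathcal X):\int|\varphi|\,d\nu<\infty\ \forall\varphi\in\mathcal F\}$, equipped with the weak topology $\sigma(\mathcal P_{\mathcal F},\mathcal F)$ (the coarsest making $\nu\mapsto\int\varphi\,d\nu$ continuous for all $\varphi\in\mathcal F$). For $\nu\in\mathcal P_{\mathcal F}$, $\mathcal T(\nu)=\sup_{(\psi,\varphi)\in\Phi}\{\int\psi\,d\mu+\int\varphi\,d\nu\}\in[0,\infty]$. $L_n=\frac1n\sum_{i=1}^n\delta_{X_i}$, with $(X_i)_{i\ge1}$ i.i.d. of law $\mu$. "Increasing" means nondecreasing.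 A left continuous increasing function $\alpha:[0,\infty)\to[0,\infty]$ (with $\alpha(+\infty)=\lim_{t\to\infty}\alpha(t)$) is a transportation function for $\mathcal T$ in $\mathcal P_{\mathcal F}$ if $\alpha(\mathcal T(\nu))\le H(\nu\mid\mu)$ for all $\nu\in\mathcal P_{\mathcal F}$; it is a deviation function for $\mathcal T$ if $\limsup_{n\to\infty}\frac1n\log\mathbb P(\mathcal T(L_n)\ge t)\le-\alpha(t)$ for all $t\ge0$. *)

theory Defs
  imports "HOL-Probability.Probability"
begin

definition borel_probs :: "'a::topological_space measure set" where
  "borel_probs = {\<nu>. prob_space \<nu> \<and> sets \<nu> = sets borel}"

text \<open>The extended-real value of \<open>\<integral> log (d\<nu>/d\<mu>) d\<nu>\<close> is written as the difference of the integrals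
  of the positive and negative parts, because the library's \<open>KL_divergence\<close> is real-valued and
  is 0 when the density is not integrable. For probability measures the subtrahend is finite, so
  the difference is never \<open>\<infinity> - \<infinity>\<close>.\<close>

definition relative_entropy :: "'a measure \<Rightarrow> 'a measure \<Rightarrow> ereal" where
  "relative_entropy \<nu> \<mu> =
    (if absolutely_continuous \<mu> \<nu>
     then enn2ereal (\<integral>\<^sup>+ x. ennreal (entropy_density (exp 1) \<mu> \<nu> x) \<partial>\<nu>)
        - enn2ereal (\<integral>\<^sup>+ x. ennreal (- entropy_density (exp 1) \<mu> \<nu> x) \<partial>\<nu>)
     else \<infinity>)"

definition function_space :: "('a \<Rightarrow> real) set \<Rightarrow> bool" where
  "function_space F \<longleftrightarrow>
     (\<lambda>x. 0) \<in> F \<and>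
     (\<forall>f\<in>F. \<forall>g\<in>F. (\<lambda>x. f x + g x) \<in> F) \<and>
     (\<forall>c. \<forall>f\<in>F. (\<lambda>x. c * f x) \<in> F)"

definition probs_integrating :: "('a::topological_space \<Rightarrow> real) set \<Rightarrow> 'a measure set" where
  "probs_integrating F = {\<nu> \<in> borel_probs. \<forall>\<phi>\<in>F. integrable \<nu> \<phi>}"

definition weak_topology_on_probs ::
  "('a::topological_space \<Rightarrow> real) set \<Rightarrow> 'a measure topology" where
  "weak_topology_on_probs F =
     topology_generated_by
       {{\<nu> \<in> probs_integrating F. (\<integral>x. \<phi> x \<partial>\<nu>) \<in> U} | \<phi> U. \<phi> \<in> F \<and> open U}"

lemma topspace_weak_topology_on_probs:
  assumes "F \<noteq> {}"
  shows "topspace (weak_topology_on_probs F) = probs_integrating F"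
proof -
  from assms obtain \<phi> where "\<phi> \<in> F" by blast
  then have "probs_integrating F
      \<in> {{\<nu> \<in> probs_integrating F. (\<integral>x. \<phi> x \<partial>\<nu>) \<in> U} | \<phi> U. \<phi> \<in> F \<and> open U}"
    by (auto intro!: exI[of _ \<phi>] exI[of _ UNIV])
  then show ?thesis
    unfolding weak_topology_on_probs_def topology_generated_by_topspace by blast
qed

definition transport_cost ::
  "'a measure \<Rightarrow> (('a \<Rightarrow> real) \<times> ('a \<Rightarrow> real)) set \<Rightarrow> 'a measure \<Rightarrow> ereal" where
  "transport_cost \<mu> \<Phi> \<nu> =
     (SUP (\<psi>, \<phi>)\<in>\<Phi>. ereal ((\<integral>x. \<psi> x \<partial>\<mu>) + (\<integral>x. \<phi> x \<partial>\<nu>)))"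

text \<open>Only for \<open>n \<ge> 1\<close>; the index runs from 1.\<close>

definition empirical_measure :: "(nat \<Rightarrow> 'a::topological_space) \<Rightarrow> nat \<Rightarrow> 'a measure" where
  "empirical_measure x n =
     measure_of UNIV (sets borel)
       (\<lambda>A. (\<Sum>i=1..n. emeasure (return borel (x i)) A) / of_nat n)"

text \<open>A left continuous nondecreasing function \<open>[0,\<infinity>) \<rightarrow> [0,\<infinity>]\<close> is represented by a function on
  \<open>real\<close> whose values at negative arguments are irrelevant.\<close>

definition rate_profile :: "(real \<Rightarrow> ereal) \<Rightarrow> bool" where
  "rate_profile \<alpha> \<longleftrightarrow>
     (\<forall>t\<ge>0. 0 \<le> \<alpha> t) \<and> mono_on {0..} \<alpha> \<and> (\<forall>t>0. continuous (at_left t) \<alpha>)"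

definition extend_to_infinity :: "(real \<Rightarrow> ereal) \<Rightarrow> ereal \<Rightarrow> ereal" where
  "extend_to_infinity \<alpha> t = (if t = \<infinity> then Lim at_top \<alpha> else \<alpha> (real_of_ereal t))"

definition transportation_function ::
  "'a::topological_space measure \<Rightarrow> ('a \<Rightarrow> real) set \<Rightarrow> (('a \<Rightarrow> real) \<times> ('a \<Rightarrow> real)) set
    \<Rightarrow> (real \<Rightarrow> ereal) \<Rightarrow> bool" where
  "transportation_function \<mu> F \<Phi> \<alpha> \<longleftrightarrow>
     rate_profile \<alpha> \<and>
     (\<forall>\<nu>\<in>probs_integrating F.
        extend_to_infinity \<alpha> (transport_cost \<mu> \<Phi> \<nu>) \<le> relative_entropy \<nu> \<mu>)"

definition log_prob :: "real \<Rightarrow> ereal" where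
  "log_prob p = (if p = 0 then -\<infinity> else ereal (ln p))"

definition deviation_function ::
  "'a::topological_space measure \<Rightarrow> (('a \<Rightarrow> real) \<times> ('a \<Rightarrow> real)) set
    \<Rightarrow> 'w measure \<Rightarrow> (nat \<Rightarrow> 'w \<Rightarrow> 'a) \<Rightarrow> (real \<Rightarrow> ereal) \<Rightarrow> bool" where
  "deviation_function \<mu> \<Phi> M X \<alpha> \<longleftrightarrow>
     rate_profile \<alpha> \<and>
     (\<forall>t\<ge>0. limsup (\<lambda>n. ereal (1 / real n) *
          log_prob (measure M {\<omega> \<in> space M.
            transport_cost \<mu> \<Phi> (empirical_measure (\<lambda>i. X i \<omega>) n) \<ge> ereal t}))
        \<le> - \<alpha> t)"

end

theory Submission
  imports Defs "HOL-Probability.Hoeffding"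
begin

text \<open>
  Both implications are halves of a Sanov principle for the empirical measures \<open>L\<^sub>n\<close>, read on the
  sets \<open>{T \<ge> t}\<close>.

  A deviation function is a transportation function because \<open>{T > t}\<close> is a union of open
  half-spaces \<open>{\<nu>. \<integral>\<phi> d\<nu> > c}\<close>. If \<open>\<nu>\<close> lies in such a half-space and has density \<open>f\<close> with respect to \<open>\<mu>\<close>, the
  product measures satisfy \<open>d\<nu>\<^sup>n/d\<mu>\<^sup>n = \<Prod>f(x\<^sub>i)\<close>. Under \<open>\<nu>\<^sup>n\<close> the weak law of large numbers puts the
  sample mean of \<open>\<phi>\<close> above \<open>c\<close> and keeps this product below \<open>exp (n (H(\<nu>|\<mu>) + \<epsilon>))\<close>, each with probability
  close to one. So \<open>P(T(L\<^sub>n) \<ge> t)\<close> is at least \<open>\<onehalf> exp (- n (H(\<nu>|\<mu>) + \<epsilon>))\<close>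
  (\<open>change_of_measure_lower_bound\<close>), and \<open>\<alpha>(t) \<le> H(\<nu>|\<mu>)\<close> for every \<open>t < T(\<nu>)\<close>. Left continuity
  of \<open>\<alpha>\<close> reaches \<open>t = T(\<nu>)\<close>.

  For the converse let \<open>L < \<alpha>(t)\<close>. The transportation inequality says that the entropy ball
  \<open>K = {\<nu>. H(\<nu>|\<mu>) \<le> L}\<close> is contained in \<open>U = {T < t}\<close>, which is open by continuity of \<open>T\<close>. It is to be shown that
  \<open>P(L\<^sub>n \<notin> U)\<close> is at most a constant times \<open>exp (- n L)\<close>. Two facts give this.

  First, \<open>K\<close> is compact (\<open>entropy_ball_finite_cover\<close>). By Alexander's subbase theorem only covers by open half-spaces
  matter, that is, families of closed half-spaces with the finite intersection property in \<open>K\<close>.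
  These are convex, so a point common to all of them is found by approximate minimisation of a
  uniformly convex functional (\<open>entropy_ball_finite_intersection\<close>). The minimising sequences converge almost everywhere, and
  the exponential moments of \<open>F\<close> keep the half-space constraints closed under such limits
  (\<open>entropy_bounded_closed_halfspace\<close>). Hence \<open>K\<close> is covered by finitely many finite intersections of open half-spaces
  inside \<open>U\<close>, and the complement of this cover is a finite union of polyhedra, finite intersections of
  closed half-spaces, that miss \<open>K\<close>.

  Second, a polyhedron \<open>Q\<close> that misses \<open>K\<close> satisfies \<open>P(L\<^sub>n \<in> Q) \<le> exp (- n L)\<close> for every \<open>n\<close>
  (\<open>closed_box_rate\<close>). Condition on the event \<open>A = {L\<^sub>n \<in> Q}\<close> and let \<open>\<nu>\<close> be the average of the conditional laws of the
  samples. By convexity \<open>\<nu> \<in> Q\<close>, and \<open>n H(\<nu>|\<mu>) \<le> - ln P(A)\<close>, since relative entropy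
  with respect to a product measure is superadditive (\<open>conditioned_mean_density\<close>). As \<open>\<nu> \<notin> K\<close>, the bound follows.
\<close>


section \<open>The entropy integrand and sets of densities of bounded entropy\<close>

text \<open>Adding \<open>1 - x\<close> does not change the integral of \<open>x ln x\<close> over a probability density, and it makes
  the integrand nonnegative. Entropies are then integrals of nonnegative functions, to which
  Fatou's lemma applies.\<close>

definition entropy_integrand :: "real \<Rightarrow> real" where
  "entropy_integrand x = x * ln x - x + 1"

text \<open>The functions \<open>x ln x - x + 1\<close> and \<open>exp s - 1\<close> are convex conjugates of each other. This
  Young inequality turns a bound on entropy into a bound on integrals against functions with
  exponential moments.\<close>

lemma entropy_young:
  fixes x s :: real
  assumes "0 \<le> x"
  shows "x * s \<le> entropy_integrand x + exp s - 1"
proof (cases "x = 0")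
  case False
  then have x: "x > 0" using assms by simp
  have "1 + (s - ln x) \<le> exp (s - ln x)" by (rule exp_ge_add_one_self)
  then have "x * (1 + (s - ln x)) \<le> x * exp (s - ln x)" using x by (intro mult_left_mono) auto
  also have "x * exp (s - ln x) = exp s" using x by (simp add: exp_diff)
  finally show ?thesis by (simp add: entropy_integrand_def algebra_simps)
qed (simp add: entropy_integrand_def)

lemma entropy_young_ln:
  fixes x :: real
  assumes "0 < x"
  shows "x * ln x = entropy_integrand x + exp (ln x) - 1"
  using assms by (simp add: entropy_integrand_def)

lemma entropy_integrand_nonneg: "0 \<le> x \<Longrightarrow> 0 \<le> entropy_integrand x"
  using entropy_young[of x 0] by simp

lemma entropy_integrand_measurable [measurable]: "entropy_integrand \<in> borel_measurable borel"
  unfolding entropy_integrand_def[abs_def] by measurable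

text \<open>The integrand is a supremum of functions affine in \<open>x\<close>; the slope that attains it at the
  midpoint bounds the two end points from below.\<close>

lemma entropy_integrand_midpoint:
  assumes "0 \<le> x" "0 \<le> y"
  shows "entropy_integrand ((x + y) / 2) \<le> (entropy_integrand x + entropy_integrand y) / 2"
proof (cases "x + y = 0")
  case True
  then have "x = 0" "y = 0" using assms by auto
  then show ?thesis by (simp add: entropy_integrand_def)
next
  case False
  define s where "s = ln ((x + y) / 2)"
  have "(x + y) / 2 * s = entropy_integrand ((x + y) / 2) + exp s - 1"
    using entropy_young_ln[of "(x + y) / 2"] False assms by (simp add: s_def)
  with entropy_young[OF assms(1), of s] entropy_young[OF assms(2), of s] show ?thesis
    by (simp add: algebra_simps add_divide_distrib)
qed

lemma entropy_integrand_tendsto: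
  assumes u: "u \<longlonglongrightarrow> x" and nn: "\<And>n. 0 \<le> u n"
  shows "(\<lambda>n. entropy_integrand (u n)) \<longlonglongrightarrow> entropy_integrand x"
proof -
  have x: "0 \<le> x" using LIMSEQ_le_const[OF u] nn by blast
  have "(\<lambda>n. u n * ln (u n)) \<longlonglongrightarrow> x * ln x"
  proof (cases "x = 0")
    case False
    then show ?thesis using u x by (intro tendsto_intros) auto
  next
    case True
    have bd: "\<bar>y * ln y\<bar> \<le> 2 * sqrt y" if "0 \<le> y" "y \<le> 1" for y :: real
    proof (cases "y = 0")
      case False
      then have y: "y > 0" using that by simp
      have "ln (1 / sqrt y) \<le> 1 / sqrt y - 1" using y by (intro ln_le_minus_one) auto
      then have "- ln y \<le> 2 / sqrt y" using y by (simp add: ln_div ln_sqrt)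
      then have "y * (- ln y) \<le> y * (2 / sqrt y)" using y by (intro mult_left_mono) auto
      also have "y * (2 / sqrt y) = 2 * sqrt y" using y
        by (simp add: field_simps)
      finally have "- (y * ln y) \<le> 2 * sqrt y" by simp
      moreover have "y * ln y \<le> 0" using that y by (intro mult_nonneg_nonpos) auto
      ultimately show ?thesis by linarith
    qed simp
    have "(\<lambda>n. 2 * sqrt (u n)) \<longlonglongrightarrow> 2 * sqrt 0"
      using u True by (intro tendsto_intros) auto
    then have *: "(\<lambda>n. 2 * sqrt (u n)) \<longlonglongrightarrow> 0" by simp
    have "\<forall>\<^sub>F n in sequentially. u n \<le> 1"
      using order_tendstoD(2)[OF u, of 1] True by (auto elim!: eventually_mono)
    then have "\<forall>\<^sub>F n in sequentially. norm (u n * ln (u n)) \<le> 2 * sqrt (u n)"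
      by eventually_elim (use bd nn in auto)
    from Lim_null_comparison[OF this *] show ?thesis using True by simp
  qed
  then show ?thesis unfolding entropy_integrand_def by (intro tendsto_add tendsto_diff tendsto_const u)
qed

definition all_exponential_moments :: "'a measure \<Rightarrow> ('a \<Rightarrow> real) \<Rightarrow> bool" where
  "all_exponential_moments M g \<longleftrightarrow>
     g \<in> borel_measurable M \<and> (\<forall>s. integrable M (\<lambda>x. exp (s * g x)))"

lemma all_exponential_moments_abs:
  assumes "all_exponential_moments M g"
  shows "integrable M (\<lambda>x. exp (s * \<bar>g x\<bar>))"
proof -
  have [measurable]: "g \<in> borel_measurable M" and int: "\<And>s. integrable M (\<lambda>x. exp (s * g x))"
    using assms by (auto simp: all_exponential_moments_def)
  show ?thesis
  proof (rule Bochner_Integration.integrable_bound)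
    show "integrable M (\<lambda>x. exp (s * g x) + exp (- s * g x))"
      by (intro Bochner_Integration.integrable_add int)
    show "AE x in M. norm (exp (s * \<bar>g x\<bar>)) \<le> norm (exp (s * g x) + exp (- s * g x))"
    proof (intro AE_I2)
      fix x
      show "norm (exp (s * \<bar>g x\<bar>)) \<le> norm (exp (s * g x) + exp (- s * g x))"
        by (cases "0 \<le> g x") (simp_all add: add_nonneg_nonneg)
    qed
  qed measurable
qed

text \<open>The densities, with respect to \<open>M\<close>, of the probability measures whose relative entropy is at most
  \<open>L \<ge> 0\<close>. A density is nonnegative everywhere, not only almost everywhere, so that the pointwise
  inequalities hold without null sets.\<close>

definition entropy_ball :: "'a measure \<Rightarrow> real \<Rightarrow> ('a \<Rightarrow> real) set" where
  "entropy_ball M L = {f \<in> borel_measurable M. (\<forall>x. 0 \<le> f x) \<and> integral\<^sup>L M f = 1 \<and>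
     (\<integral>\<^sup>+x. ennreal (entropy_integrand (f x)) \<partial>M) \<le> ennreal L}"

context prob_space
begin

lemma finite_entropy_integrable_mult:
  assumes [measurable]: "f \<in> borel_measurable M" and nn: "\<And>x. 0 \<le> f x"
    and k: "(\<integral>\<^sup>+x. ennreal (entropy_integrand (f x)) \<partial>M) < \<infinity>"
    and g: "all_exponential_moments M g"
  shows "integrable M (\<lambda>x. g x * f x)"
proof (rule Bochner_Integration.integrable_bound)
  have "integrable M (\<lambda>x. entropy_integrand (f x))"
    using k by (intro integrableI_nonneg) (auto simp: entropy_integrand_nonneg nn)
  then show "integrable M (\<lambda>x. entropy_integrand (f x) + exp (1 * \<bar>g x\<bar>))"
    by (intro Bochner_Integration.integrable_add all_exponential_moments_abs g)
  have [measurable]: "g \<in> borel_measurable M" using g by (simp add: all_exponential_moments_def)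
  show "(\<lambda>x. g x * f x) \<in> borel_measurable M" by measurable
  show "AE x in M. norm (g x * f x) \<le> norm (entropy_integrand (f x) + exp (1 * \<bar>g x\<bar>))"
  proof (intro AE_I2)
    fix x
    have "f x * \<bar>g x\<bar> \<le> entropy_integrand (f x) + exp \<bar>g x\<bar>"
      using entropy_young[OF nn, of x "\<bar>g x\<bar>"] by simp
    then show "norm (g x * f x) \<le> norm (entropy_integrand (f x) + exp (1 * \<bar>g x\<bar>))"
      using nn[of x] entropy_integrand_nonneg[OF nn, of x] by (simp add: abs_mult mult.commute)
  qed
qed

lemma all_exponential_moments_const: "all_exponential_moments M (\<lambda>x. c)"
  by (simp add: all_exponential_moments_def)

lemma finite_entropy_integrable:
  assumes "f \<in> borel_measurable M" "\<And>x. 0 \<le> f x"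
    "(\<integral>\<^sup>+x. ennreal (entropy_integrand (f x)) \<partial>M) < \<infinity>"
  shows "integrable M f"
  using finite_entropy_integrable_mult[OF assms all_exponential_moments_const[of 1]] by simp

lemma entropy_ballD:
  assumes "f \<in> entropy_ball M L"
  shows "f \<in> borel_measurable M" "\<And>x. 0 \<le> f x" "integral\<^sup>L M f = 1"
    "(\<integral>\<^sup>+x. ennreal (entropy_integrand (f x)) \<partial>M) \<le> ennreal L"
    "(\<integral>\<^sup>+x. ennreal (entropy_integrand (f x)) \<partial>M) < \<infinity>" "integrable M f"
proof -
  show *: "f \<in> borel_measurable M" "\<And>x. 0 \<le> f x" "integral\<^sup>L M f = 1"
    and L: "(\<integral>\<^sup>+x. ennreal (entropy_integrand (f x)) \<partial>M) \<le> ennreal L"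
    using assms by (auto simp: entropy_ball_def)
  from L show "(\<integral>\<^sup>+x. ennreal (entropy_integrand (f x)) \<partial>M) < \<infinity>"
    using le_less_trans[OF L] by simp
  with * show "integrable M f" by (intro finite_entropy_integrable)
qed

lemma entropy_ball_integrable_mult:
  assumes "f \<in> entropy_ball M L" "all_exponential_moments M g"
  shows "integrable M (\<lambda>x. g x * f x)"
  using entropy_ballD[OF assms(1)] assms(2) by (intro finite_entropy_integrable_mult)

lemma entropy_ball_midpoint:
  assumes f: "f \<in> entropy_ball M L" and g: "g \<in> entropy_ball M L"
  shows "(\<lambda>x. (f x + g x) / 2) \<in> entropy_ball M L"
proof -
  note F = entropy_ballD[OF f] and G = entropy_ballD[OF g]
  have [measurable]: "f \<in> borel_measurable M" "g \<in> borel_measurable M" using F G by auto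
  have "(\<integral>\<^sup>+x. ennreal (entropy_integrand ((f x + g x) / 2)) \<partial>M)
      \<le> (\<integral>\<^sup>+x. ennreal (1/2) * (ennreal (entropy_integrand (f x)) + ennreal (entropy_integrand (g x))) \<partial>M)"
  proof (intro nn_integral_mono)
    fix x
    have "ennreal (entropy_integrand ((f x + g x) / 2)) \<le> ennreal (1 / 2 * (entropy_integrand (f x) + entropy_integrand (g x)))"
      using entropy_integrand_midpoint[OF F(2) G(2), of x x] by (intro ennreal_leI) simp
    also have "\<dots> = ennreal (1/2) * (ennreal (entropy_integrand (f x)) + ennreal (entropy_integrand (g x)))"
      by (simp only: ennreal_mult ennreal_plus entropy_integrand_nonneg F(2) G(2) add_nonneg_nonneg
          zero_le_divide_1_iff zero_le_numeral)
    finally show "ennreal (entropy_integrand ((f x + g x) / 2)) \<le> \<dots>" .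
  qed
  also have "\<dots> = ennreal (1/2) * ((\<integral>\<^sup>+x. ennreal (entropy_integrand (f x)) \<partial>M) + (\<integral>\<^sup>+x. ennreal (entropy_integrand (g x)) \<partial>M))"
    by (simp add: nn_integral_cmult nn_integral_add del: ennreal_half)
  also have "\<dots> \<le> ennreal (1/2) * (ennreal L + ennreal L)"
    using F(4) G(4) by (intro mult_left_mono add_mono) auto
  also have "\<dots> = ennreal L"
    by (cases "0 \<le> L") (auto simp flip: ennreal_plus ennreal_mult simp: ennreal_neg simp del: ennreal_half)
  finally show ?thesis using F G unfolding entropy_ball_def by auto
qed

lemma entropy_Fatou:
  assumes f: "\<And>n. f n \<in> borel_measurable M" "\<And>n x. 0 \<le> f n x"
    and k: "\<And>n. (\<integral>\<^sup>+x. ennreal (entropy_integrand (f n x)) \<partial>M) \<le> ennreal L"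
    and lim: "AE x in M. (\<lambda>n. f n x) \<longlonglongrightarrow> h x"
    and h: "h \<in> borel_measurable M" "\<And>x. 0 \<le> h x"
  shows "(\<integral>\<^sup>+x. ennreal (entropy_integrand (h x)) \<partial>M) \<le> ennreal L"
proof -
  note [measurable] = f(1) h(1)
  have "(\<integral>\<^sup>+x. ennreal (entropy_integrand (h x)) \<partial>M)
     = (\<integral>\<^sup>+x. liminf (\<lambda>n. ennreal (entropy_integrand (f n x))) \<partial>M)"
  proof (rule nn_integral_cong_AE)
    show "AE x in M. ennreal (entropy_integrand (h x)) = liminf (\<lambda>n. ennreal (entropy_integrand (f n x)))"
      using lim
    proof eventually_elim
      case (elim x)
      have "(\<lambda>n. ennreal (entropy_integrand (f n x))) \<longlonglongrightarrow> ennreal (entropy_integrand (h x))"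
        using entropy_integrand_tendsto[OF elim f(2)] by (intro tendsto_ennrealI)
      then show ?case by (rule lim_imp_Liminf[OF trivial_limit_sequentially, symmetric])
    qed
  qed
  also have "\<dots> \<le> liminf (\<lambda>n. \<integral>\<^sup>+x. ennreal (entropy_integrand (f n x)) \<partial>M)"
    by (intro nn_integral_liminf) measurable
  also have "\<dots> \<le> ennreal L"
    by (rule order_trans[OF Liminf_mono[where g="\<lambda>_. ennreal L"]]) (auto simp: k Liminf_const)
  finally show ?thesis .
qed

text \<open>For \<open>s > 0\<close> the Young inequality makes \<open>k(f) + exp (s|g|) - 1 + s g f\<close> nonnegative, where \<open>k\<close> is the
  entropy integrand. Fatou's lemma for this expression, together with the entropy bound \<open>L\<close>, gives
  \<open>\<integral>g h \<le> a + L/s\<close>. Let \<open>s\<close> tend to infinity. Applied to \<open>g\<close> and \<open>- g\<close> it says that integrals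
  of functions with exponential moments pass to almost everywhere limits; this replaces uniform
  integrability.\<close>

lemma entropy_bounded_closed_halfspace:
  assumes f: "\<And>n. f n \<in> borel_measurable M" "\<And>n x. 0 \<le> f n x"
    and k: "\<And>n. (\<integral>\<^sup>+x. ennreal (entropy_integrand (f n x)) \<partial>M) \<le> ennreal L"
    and lim: "AE x in M. (\<lambda>n. f n x) \<longlonglongrightarrow> h x"
    and h: "h \<in> borel_measurable M" "\<And>x. 0 \<le> h x"
    and g: "all_exponential_moments M g"
    and a: "\<And>n. (\<integral>x. g x * f n x \<partial>M) \<le> a"
    and L: "0 \<le> L"
  shows "(\<integral>x. g x * h x \<partial>M) \<le> a"
proof -
  note [measurable] = f(1) h(1)
  have [measurable]: "g \<in> borel_measurable M" using g by (simp add: all_exponential_moments_def)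
  have kfin: "(\<integral>\<^sup>+x. ennreal (entropy_integrand (f n x)) \<partial>M) < \<infinity>" for n
    using le_less_trans[OF k] by simp
  have khfin: "(\<integral>\<^sup>+x. ennreal (entropy_integrand (h x)) \<partial>M) < \<infinity>"
    using le_less_trans[OF entropy_Fatou[OF f k lim h]] by simp
  have ki: "integrable M (\<lambda>x. entropy_integrand (f n x))" for n
    using kfin[of n] by (intro integrableI_nonneg) (auto simp: entropy_integrand_nonneg f)
  have kle: "(\<integral>x. entropy_integrand (f n x) \<partial>M) \<le> L" for n
    using k[of n] L ki[of n]
    by (subst (asm) nn_integral_eq_integral) (auto simp: entropy_integrand_nonneg f)
  have gf: "integrable M (\<lambda>x. g x * f n x)" for n
    by (rule finite_entropy_integrable_mult[OF f kfin g])
  have gh: "integrable M (\<lambda>x. g x * h x)"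
    by (rule finite_entropy_integrable_mult[OF h khfin g])
  have main: "(\<integral>x. g x * h x \<partial>M) \<le> a + L / s" if s: "s > 0" for s
  proof -
    define E where "E x = exp (s * \<bar>g x\<bar>) - 1" for x
    define w where "w n x = entropy_integrand (f n x) + E x + s * (g x * f n x)" for n x
    have Ei: "integrable M E"
      unfolding E_def using all_exponential_moments_abs[OF g] by (intro Bochner_Integration.integrable_diff) auto
    have [measurable]: "E \<in> borel_measurable M" using Ei by auto
    have low: "0 \<le> entropy_integrand y + E x + s * (g x * y)" if "0 \<le> y" for x y
    proof -
      have "y * (s * \<bar>g x\<bar>) \<le> entropy_integrand y + E x"
        using entropy_young[OF that, of "s * \<bar>g x\<bar>"] by (simp add: E_def)
      moreover have "- (s * (g x * y)) \<le> y * (s * \<bar>g x\<bar>)"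
      proof -
        have "s * y * (- g x) \<le> s * y * \<bar>g x\<bar>" using s that by (intro mult_left_mono) auto
        then show ?thesis by (simp add: algebra_simps)
      qed
      ultimately show ?thesis by linarith
    qed
    have wnn: "0 \<le> w n x" for n x unfolding w_def by (rule low[OF f(2)])
    have wi: "integrable M (w n)" for n
      unfolding w_def using ki Ei gf by auto
    have [measurable]: "w n \<in> borel_measurable M" for n using wi by auto
    have wle: "(\<integral>\<^sup>+x. ennreal (w n x) \<partial>M) \<le> ennreal (L + integral\<^sup>L M E + s * a)" for n
    proof -
      have "(\<integral>x. w n x \<partial>M) = (\<integral>x. entropy_integrand (f n x) \<partial>M) + integral\<^sup>L M E + s * (\<integral>x. g x * f n x \<partial>M)"
        unfolding w_def using ki Ei gf by simp
      also have "\<dots> \<le> L + integral\<^sup>L M E + s * a"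
        using kle[of n] a[of n] s by (intro add_mono mult_left_mono) auto
      finally show ?thesis
        using wi[of n] by (subst nn_integral_eq_integral) (auto simp: wnn intro!: ennreal_leI)
    qed
    define v where "v x = E x + s * (g x * h x) + entropy_integrand (h x)" for x
    have khi: "integrable M (\<lambda>x. entropy_integrand (h x))"
      using khfin by (intro integrableI_nonneg) (auto simp: entropy_integrand_nonneg h)
    have vnn: "0 \<le> v x" for x using low[OF h(2), of x x] by (simp add: v_def algebra_simps)
    have vi: "integrable M v" unfolding v_def using Ei gh khi by auto
    have "(\<integral>\<^sup>+x. ennreal (v x) \<partial>M) = (\<integral>\<^sup>+x. liminf (\<lambda>n. ennreal (w n x)) \<partial>M)"
    proof (rule nn_integral_cong_AE)
      show "AE x in M. ennreal (v x) = liminf (\<lambda>n. ennreal (w n x))"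
        using lim
      proof eventually_elim
        case (elim x)
        have "(\<lambda>n. w n x) \<longlonglongrightarrow> entropy_integrand (h x) + E x + s * (g x * h x)"
          unfolding w_def by (intro tendsto_intros entropy_integrand_tendsto elim f)
        then have "(\<lambda>n. ennreal (w n x)) \<longlonglongrightarrow> ennreal (v x)"
          by (intro tendsto_ennrealI) (simp add: v_def algebra_simps)
        then show ?case by (rule lim_imp_Liminf[OF trivial_limit_sequentially, symmetric])
      qed
    qed
    also have "\<dots> \<le> liminf (\<lambda>n. \<integral>\<^sup>+x. ennreal (w n x) \<partial>M)"
      by (intro nn_integral_liminf) measurable
    also have "\<dots> \<le> ennreal (L + integral\<^sup>L M E + s * a)"
      by (rule order_trans[OF Liminf_mono[where g="\<lambda>_. ennreal (L + integral\<^sup>L M E + s * a)"]])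
        (auto simp: wle Liminf_const)
    finally have le: "(\<integral>\<^sup>+x. ennreal (v x) \<partial>M) \<le> ennreal (L + integral\<^sup>L M E + s * a)" .
    have pos: "0 \<le> L + integral\<^sup>L M E + s * a"
    proof -
      have "0 \<le> integral\<^sup>L M (w 0)" by (intro integral_nonneg_AE) (auto simp: wnn)
      also have "integral\<^sup>L M (w 0) = (\<integral>x. entropy_integrand (f 0 x) \<partial>M) + integral\<^sup>L M E + s * (\<integral>x. g x * f 0 x \<partial>M)"
        unfolding w_def using ki Ei gf by simp
      also have "\<dots> \<le> L + integral\<^sup>L M E + s * a"
        using kle[of 0] a[of 0] s by (intro add_mono mult_left_mono) auto
      finally show ?thesis .
    qed
    have "integral\<^sup>L M v \<le> L + integral\<^sup>L M E + s * a"
      using le vi pos by (subst (asm) nn_integral_eq_integral) (auto simp: vnn)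
    moreover have "integral\<^sup>L M E + s * (\<integral>x. g x * h x \<partial>M) \<le> integral\<^sup>L M v"
    proof -
      have "integral\<^sup>L M v = integral\<^sup>L M E + s * (\<integral>x. g x * h x \<partial>M) + (\<integral>x. entropy_integrand (h x) \<partial>M)"
        unfolding v_def using Ei gh khi by simp
      moreover have "0 \<le> (\<integral>x. entropy_integrand (h x) \<partial>M)"
        by (intro integral_nonneg_AE) (auto simp: entropy_integrand_nonneg h)
      ultimately show ?thesis by simp
    qed
    ultimately have "s * (\<integral>x. g x * h x \<partial>M) \<le> L + s * a" by linarith
    then show ?thesis using s by (simp add: field_simps)
  qed
  have "(\<lambda>n. a + L * inverse (real (Suc n))) \<longlonglongrightarrow> a + L * 0"
    by (intro tendsto_intros LIMSEQ_inverse_real_of_nat)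
  then show ?thesis
    using main[of "real (Suc _)"]
    by (intro LIMSEQ_le_const[where X="\<lambda>n. a + L * inverse (real (Suc n))" and x=a])
      (auto simp: divide_inverse)
qed

text \<open>The constants \<open>1\<close> and \<open>- 1\<close> have exponential moments, so no mass is lost in the limit.\<close>

lemma entropy_ball_closed:
  assumes f: "\<And>n. f n \<in> entropy_ball M L" and L: "0 \<le> L"
    and lim: "AE x in M. (\<lambda>n. f n x) \<longlonglongrightarrow> h x"
    and h: "h \<in> borel_measurable M" "\<And>x. 0 \<le> h x"
  shows "h \<in> entropy_ball M L"
proof -
  note F = entropy_ballD[OF f]
  have k: "(\<integral>\<^sup>+x. ennreal (entropy_integrand (h x)) \<partial>M) \<le> ennreal L"
    by (rule entropy_Fatou[OF F(1) F(2) F(4) lim h])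
  have "(\<integral>x. 1 * h x \<partial>M) \<le> 1"
    by (rule entropy_bounded_closed_halfspace[OF F(1) F(2) F(4) lim h all_exponential_moments_const _ L])
      (simp add: F)
  moreover have "(\<integral>x. (-1) * h x \<partial>M) \<le> -1"
    by (rule entropy_bounded_closed_halfspace[OF F(1) F(2) F(4) lim h all_exponential_moments_const _ L])
      (simp add: F)
  ultimately have "integral\<^sup>L M h = 1" by simp
  with k h show ?thesis by (simp add: entropy_ball_def)
qed

end

section \<open>Finite intersections of half-spaces in entropy balls\<close>

text \<open>Uniform convexity of \<open>x \<mapsto> 1/(1 + x)\<close>, with the defect measured by the values of the
  function itself. With \<open>p\<close> and \<open>q\<close> the two values, the defect is \<open>(p - q)\<^sup>2 / (2 (p + q))\<close> and
  \<open>p + q \<le> 2\<close>.\<close>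

lemma resolvent_midpoint:
  fixes x y :: real
  assumes "0 \<le> x" "0 \<le> y"
  shows "(1 / (1 + x) - 1 / (1 + y))\<^sup>2 / 4 \<le> (1 / (1 + x) + 1 / (1 + y)) / 2 - 1 / (1 + (x + y) / 2)"
proof -
  define u v where "u = 1 + x" and "v = 1 + y"
  have u: "u \<ge> 1" "v \<ge> 1" using assms by (auto simp: u_def v_def)
  have 1: "1 + (x + y) / 2 = (u + v) / 2" by (simp add: u_def v_def field_simps)
  have 2: "(1 / u + 1 / v) / 2 - 1 / ((u + v) / 2) = (u - v)\<^sup>2 / (2 * u * v * (u + v))"
    using u by (simp add: divide_simps power2_eq_square) (simp add: algebra_simps)
  have 3: "(1 / u - 1 / v)\<^sup>2 / 4 = (u - v)\<^sup>2 / (4 * u * v * (u * v))"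
    using u by (simp add: divide_simps power2_eq_square) (simp add: algebra_simps)
  have "2 * u * v * (u + v) \<le> 4 * u * v * (u * v)"
  proof -
    have "0 \<le> (u - 1) * v + u * (v - 1)" using u by (intro add_nonneg_nonneg mult_nonneg_nonneg) auto
    then have "u + v \<le> 2 * (u * v)" by (simp add: algebra_simps)
    then have "2 * u * v * (u + v) \<le> 2 * u * v * (2 * (u * v))" using u by (intro mult_left_mono) auto
    then show ?thesis by simp
  qed
  moreover have "0 < 2 * u * v * (u + v)" using u by simp
  ultimately have "(u - v)\<^sup>2 / (4 * u * v * (u * v)) \<le> (u - v)\<^sup>2 / (2 * u * v * (u + v))"
    by (intro divide_left_mono mult_pos_pos) (use u in auto)
  then show ?thesis using 2 3 unfolding 1 unfolding u_def[symmetric] v_def[symmetric] by simp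
qed

lemma AE_summable_of_summable_integrals:
  fixes u :: "nat \<Rightarrow> 'a \<Rightarrow> real"
  assumes i: "\<And>n. integrable M (u n)" and s: "summable (\<lambda>n. \<integral>x. \<bar>u n x\<bar> \<partial>M)"
  shows "AE x in M. summable (\<lambda>n. \<bar>u n x\<bar>)"
proof -
  have [measurable]: "u n \<in> borel_measurable M" for n using i by auto
  have "(\<integral>\<^sup>+x. (\<Sum>n. ennreal \<bar>u n x\<bar>) \<partial>M) = (\<Sum>n. \<integral>\<^sup>+x. ennreal \<bar>u n x\<bar> \<partial>M)"
    by (intro nn_integral_suminf) measurable
  also have "\<dots> = (\<Sum>n. ennreal (\<integral>x. \<bar>u n x\<bar> \<partial>M))"
    by (simp add: nn_integral_eq_integral i)
  also have "\<dots> \<noteq> \<infinity>"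
    by (subst suminf_ennreal2[OF _ s]) auto
  finally have "AE x in M. (\<Sum>n. ennreal \<bar>u n x\<bar>) \<noteq> \<infinity>"
    by (intro nn_integral_PInf_AE) measurable
  then show ?thesis
  proof eventually_elim
    case (elim x)
    then show ?case by (intro summable_suminf_not_top) auto
  qed
qed

context prob_space
begin

definition ball_constrained :: "real \<Rightarrow> (('a \<Rightarrow> real) \<times> real) set \<Rightarrow> ('a \<Rightarrow> real) set" where
  "ball_constrained L H = {f \<in> entropy_ball M L. \<forall>(g, a)\<in>H. (\<integral>x. g x * f x \<partial>M) \<le> a}"

lemma ball_constrained_midpoint:
  assumes f: "f \<in> ball_constrained L H" and f': "f' \<in> ball_constrained L H"
    and H: "\<And>g a. (g, a) \<in> H \<Longrightarrow> all_exponential_moments M g"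
  shows "(\<lambda>x. (f x + f' x) / 2) \<in> ball_constrained L H"
proof -
  have b: "f \<in> entropy_ball M L" "f' \<in> entropy_ball M L"
    using f f' by (auto simp: ball_constrained_def)
  have "(\<integral>x. g x * ((f x + f' x) / 2) \<partial>M) \<le> a" if ga: "(g, a) \<in> H" for g a
  proof -
    have "integrable M (\<lambda>x. g x * f x)" "integrable M (\<lambda>x. g x * f' x)"
      using b H[OF ga] by (auto intro: entropy_ball_integrable_mult)
    then have "(\<integral>x. (g x * f x + g x * f' x) / 2 \<partial>M) = ((\<integral>x. g x * f x \<partial>M) + (\<integral>x. g x * f' x \<partial>M)) / 2"
      by simp
    moreover have "(\<integral>x. g x * f x \<partial>M) \<le> a" "(\<integral>x. g x * f' x \<partial>M) \<le> a"
      using f f' ga by (auto simp: ball_constrained_def)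
    ultimately show ?thesis by (simp add: algebra_simps)
  qed
  then show ?thesis
    using entropy_ball_midpoint[OF b] by (auto simp: ball_constrained_def)
qed

text \<open>A bounded convex functional that selects points of a convex set of densities. Since it takes
  values in \<open>[0, 1]\<close> and its convexity defect controls a distance, near-minimisers are close to each
  other without any integrability assumption.\<close>

definition resolvent_integral :: "('a \<Rightarrow> real) \<Rightarrow> real" where
  "resolvent_integral f = (\<integral>x. 1 / (1 + f x) \<partial>M)"

lemma resolvent_integrable:
  fixes f :: "'a \<Rightarrow> real"
  assumes [measurable]: "f \<in> borel_measurable M" and nn: "\<And>x. 0 \<le> f x"
  shows "integrable M (\<lambda>x. 1 / (1 + f x))"
proof (rule integrable_const_bound[where B=1])
  show "AE x in M. norm (1 / (1 + f x)) \<le> 1" using nn by (intro AE_I2) (simp add: divide_le_eq add_pos_nonneg)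
qed measurable

lemma resolvent_integral_bounds:
  fixes f :: "'a \<Rightarrow> real"
  assumes "f \<in> borel_measurable M" and nn: "\<And>x. 0 \<le> f x"
  shows "0 \<le> resolvent_integral f" "resolvent_integral f \<le> 1"
proof -
  show "0 \<le> resolvent_integral f" unfolding resolvent_integral_def
    using nn by (intro integral_nonneg_AE AE_I2) (simp add: add_nonneg_nonneg)
  have "resolvent_integral f \<le> (\<integral>x. 1 \<partial>M)" unfolding resolvent_integral_def
    using nn by (intro integral_mono resolvent_integrable assms integrable_const) (auto simp: divide_le_eq add_pos_nonneg)
  then show "resolvent_integral f \<le> 1" by (simp add: prob_space)
qed

text \<open>The midpoint defect bounds the square of the difference \<open>u\<close>; the passage to the first power uses
  \<open>2 \<epsilon> |u| \<le> u\<^sup>2 + \<epsilon>\<^sup>2\<close>.\<close>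

lemma resolvent_L1_close:
  assumes f [measurable]: "f \<in> borel_measurable M" "f' \<in> borel_measurable M"
    and nn: "\<And>x. 0 \<le> f x" "\<And>x. 0 \<le> f' x"
    and up: "resolvent_integral f \<le> c + \<epsilon>\<^sup>2 / 8" "resolvent_integral f' \<le> c + \<epsilon>\<^sup>2 / 8"
    and lo: "c - \<epsilon>\<^sup>2 / 8 \<le> resolvent_integral (\<lambda>x. (f x + f' x) / 2)"
    and e: "\<epsilon> > 0"
  shows "(\<integral>x. \<bar>1 / (1 + f x) - 1 / (1 + f' x)\<bar> \<partial>M) \<le> \<epsilon>"
proof -
  define u where "u x = 1 / (1 + f x) - 1 / (1 + f' x)" for x
  have i: "integrable M (\<lambda>x. 1 / (1 + f x))" "integrable M (\<lambda>x. 1 / (1 + f' x))"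
    "integrable M (\<lambda>x. 1 / (1 + (f x + f' x) / 2))"
    using f nn by (auto intro!: resolvent_integrable)
  have ui: "integrable M u" unfolding u_def using i by auto
  have [measurable]: "u \<in> borel_measurable M" using ui by auto
  define d where "d x = (1 / (1 + f x) + 1 / (1 + f' x)) / 2 - 1 / (1 + (f x + f' x) / 2)" for x
  have di: "integrable M d"
    unfolding d_def by (intro Bochner_Integration.integrable_add Bochner_Integration.integrable_diff
        integrable_divide i)
  have dI: "(\<integral>x. d x \<partial>M) = (resolvent_integral f + resolvent_integral f') / 2
      - resolvent_integral (\<lambda>x. (f x + f' x) / 2)"
    unfolding resolvent_integral_def d_def using i
    by (simp only: Bochner_Integration.integral_add Bochner_Integration.integral_diff integral_divide_zero
        Bochner_Integration.integrable_add integrable_divide)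
  have alg: "(4 * d + \<epsilon>\<^sup>2) / (2 * \<epsilon>) = 2 / \<epsilon> * d + \<epsilon> / 2" for d
    using e by (simp add: field_simps power2_eq_square)
  have "(\<integral>x. \<bar>u x\<bar> \<partial>M) \<le> (\<integral>x. 2 / \<epsilon> * d x + \<epsilon> / 2 \<partial>M)"
  proof (rule integral_mono)
    show "integrable M (\<lambda>x. \<bar>u x\<bar>)" using ui by auto
    show "integrable M (\<lambda>x. 2 / \<epsilon> * d x + \<epsilon> / 2)"
      by (intro Bochner_Integration.integrable_add integrable_const integrable_mult_right di)
    fix x
    have "0 \<le> (\<bar>u x\<bar> - \<epsilon>)\<^sup>2" by simp
    then have "2 * \<epsilon> * \<bar>u x\<bar> \<le> (u x)\<^sup>2 + \<epsilon>\<^sup>2" by (simp add: power2_diff mult_ac)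
    also have "\<dots> \<le> 4 * d x + \<epsilon>\<^sup>2"
      using resolvent_midpoint[OF nn(1) nn(2), of x x] by (simp add: u_def d_def)
    finally have "\<bar>u x\<bar> \<le> (4 * d x + \<epsilon>\<^sup>2) / (2 * \<epsilon>)" using e by (simp add: pos_le_divide_eq mult_ac)
    also have "\<dots> = 2 / \<epsilon> * d x + \<epsilon> / 2" by (rule alg)
    finally show "\<bar>u x\<bar> \<le> 2 / \<epsilon> * d x + \<epsilon> / 2" .
  qed
  also have "\<dots> = 2 / \<epsilon> * (\<integral>x. d x \<partial>M) + \<epsilon> / 2"
    using di by (subst Bochner_Integration.integral_add) (auto simp: prob_space)
  also have "(\<integral>x. d x \<partial>M) = (resolvent_integral f + resolvent_integral f') / 2 - resolvent_integral (\<lambda>x. (f x + f' x) / 2)"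
    by (rule dI)
  also have "2 / \<epsilon> * \<dots> + \<epsilon> / 2 \<le> 2 / \<epsilon> * (\<epsilon>\<^sup>2 / 4) + \<epsilon> / 2"
  proof (intro add_right_mono mult_left_mono)
    show "(resolvent_integral f + resolvent_integral f') / 2 - resolvent_integral (\<lambda>x. (f x + f' x) / 2)
        \<le> \<epsilon>\<^sup>2 / 4" using up lo by argo
  qed (use e in simp)
  also have "\<dots> = \<epsilon>" using e by (simp add: power2_eq_square)
  finally show ?thesis by (simp add: u_def)
qed

text \<open>Let \<open>m H\<close> be the infimum of the resolvent integral under the finitely many constraints \<open>H\<close>, and
  \<open>\<Gamma>\<close> the supremum of all \<open>m H\<close>. Along increasing sets \<open>Hs n\<close> with \<open>m (Hs n)\<close> tending to \<open>\<Gamma>\<close>, any two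
  densities that satisfy \<open>Hs n\<close> and nearly attain \<open>\<Gamma>\<close> are close, because their midpoint also satisfies
  \<open>Hs n\<close>. So all such sequences have one common limit. A single further constraint can be added to every
  \<open>Hs n\<close> without raising the infimum above \<open>\<Gamma>\<close>; hence the common limit satisfies it as well.\<close>

lemma entropy_ball_finite_intersection:
  assumes H: "\<And>g a. (g, a) \<in> \<H> \<Longrightarrow> all_exponential_moments M g" and L: "0 \<le> L"
    and fip: "\<And>H. finite H \<Longrightarrow> H \<subseteq> \<H> \<Longrightarrow> ball_constrained L H \<noteq> {}"
  shows "ball_constrained L \<H> \<noteq> {}"
proof -
  let ?D = "ball_constrained L"
  have Dball: "f \<in> entropy_ball M L" if "f \<in> ?D H" for f H
    using that by (simp add: ball_constrained_def)
  have Dm [measurable_dest]: "f \<in> borel_measurable M" if "f \<in> ?D H" for f H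
    using entropy_ballD[OF Dball[OF that]] by auto
  have Dn: "0 \<le> f x" if "f \<in> ?D H" for f H x
    using entropy_ballD[OF Dball[OF that]] by auto
  have Dmono: "?D H' \<subseteq> ?D H" if "H \<subseteq> H'" for H H'
    using that by (auto simp: ball_constrained_def)
  define m where "m H = Inf (resolvent_integral ` ?D H)" for H
  have bdd: "bdd_below (resolvent_integral ` ?D H)" for H
    by (rule bdd_belowI[where m=0]) (auto intro: resolvent_integral_bounds(1)[OF Dm Dn])
  have m_le: "m H \<le> resolvent_integral f" if "f \<in> ?D H" for f H
    unfolding m_def using bdd that by (intro cInf_lower) auto
  have m1: "m H \<le> 1" if fH: "finite H" "H \<subseteq> \<H>" for H
  proof -
    obtain f where f: "f \<in> ?D H" using fip[OF fH] by auto
    from m_le[OF f] resolvent_integral_bounds(2)[OF Dm[OF f] Dn[OF f]] show ?thesis by simp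
  qed
  define \<Gamma> where "\<Gamma> = Sup (m ` {H. finite H \<and> H \<subseteq> \<H>})"
  have bda: "bdd_above (m ` {H. finite H \<and> H \<subseteq> \<H>})"
    by (intro bdd_aboveI[where M=1]) (auto intro: m1)
  have m_le_\<Gamma>: "m H \<le> \<Gamma>" if "finite H" "H \<subseteq> \<H>" for H
    unfolding \<Gamma>_def using bda that by (intro cSup_upper) auto
  define \<epsilon> where "\<epsilon> n = (1 / 2 :: real) ^ n" for n :: nat
  have e: "\<epsilon> n > 0" for n by (simp add: \<epsilon>_def)
  have e_mono: "\<epsilon> k \<le> \<epsilon> n" if "n \<le> k" for n k
    unfolding \<epsilon>_def using that by (intro power_decreasing) auto
  have "\<exists>H. finite H \<and> H \<subseteq> \<H> \<and> \<Gamma> - (\<epsilon> n)\<^sup>2 / 8 < m H" for n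
  proof -
    have "\<Gamma> - (\<epsilon> n)\<^sup>2 / 8 < \<Gamma>" using e[of n] by simp
    then show ?thesis
      using less_cSup_iff[OF _ bda, of "\<Gamma> - (\<epsilon> n)\<^sup>2 / 8"] unfolding \<Gamma>_def[symmetric] by auto
  qed
  then obtain H0 where H0: "\<And>n. finite (H0 n)" "\<And>n. H0 n \<subseteq> \<H>" "\<And>n. \<Gamma> - (\<epsilon> n)\<^sup>2 / 8 < m (H0 n)"
    by metis
  define Hs where "Hs n = (\<Union>k\<le>n. H0 k)" for n
  have Hs: "finite (Hs n)" "Hs n \<subseteq> \<H>" for n using H0 by (auto simp: Hs_def)
  have Hs_mono: "Hs n \<subseteq> Hs k" if "n \<le> k" for n k using that order_trans unfolding Hs_def by blast
  have H0_Hs: "H0 n \<subseteq> Hs n" for n by (auto simp: Hs_def)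
  have near: "\<exists>f. \<forall>n. f n \<in> ?D (Hs n \<union> E) \<and> resolvent_integral (f n) \<le> \<Gamma> + (\<epsilon> n)\<^sup>2 / 8"
    if E: "finite E" "E \<subseteq> \<H>" for E
  proof -
    have "\<exists>f. f \<in> ?D (Hs n \<union> E) \<and> resolvent_integral f \<le> \<Gamma> + (\<epsilon> n)\<^sup>2 / 8" for n
    proof -
      have fin: "finite (Hs n \<union> E)" "Hs n \<union> E \<subseteq> \<H>" using E Hs by auto
      have "m (Hs n \<union> E) < \<Gamma> + (\<epsilon> n)\<^sup>2 / 8" using m_le_\<Gamma>[OF fin] zero_less_power[OF e[of n], of 2] by linarith
      then obtain f where "f \<in> ?D (Hs n \<union> E)" "resolvent_integral f < \<Gamma> + (\<epsilon> n)\<^sup>2 / 8"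
        unfolding m_def using cInf_less_iff[OF _ bdd] fip[OF fin] by auto
      then show ?thesis by (intro exI[of _ f]) auto
    qed
    then show ?thesis by metis
  qed
  have close: "(\<integral>x. \<bar>1 / (1 + f x) - 1 / (1 + f' x)\<bar> \<partial>M) \<le> \<epsilon> n"
    if f: "f \<in> ?D (Hs n)" "f' \<in> ?D (Hs n)" "resolvent_integral f \<le> \<Gamma> + (\<epsilon> n)\<^sup>2 / 8"
      "resolvent_integral f' \<le> \<Gamma> + (\<epsilon> n)\<^sup>2 / 8" for f f' n
  proof (rule resolvent_L1_close[OF Dm[OF f(1)] Dm[OF f(2)] Dn[OF f(1)] Dn[OF f(2)] f(3,4) _ e])
    have "f \<in> ?D (H0 n)" "f' \<in> ?D (H0 n)" using f Dmono[OF H0_Hs] by auto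
    then have "(\<lambda>x. (f x + f' x) / 2) \<in> ?D (H0 n)"
      using H0(2) H by (intro ball_constrained_midpoint) auto
    from m_le[OF this] H0(3)[of n] show "\<Gamma> - (\<epsilon> n)\<^sup>2 / 8 \<le> resolvent_integral (\<lambda>x. (f x + f' x) / 2)"
      by simp
  qed
  \<comment> \<open>The tolerances are summable, so closeness in mean yields convergence almost everywhere.\<close>
  have sum_e: "summable \<epsilon>" unfolding \<epsilon>_def by (intro summable_geometric) simp

  obtain f where f: "\<And>n. f n \<in> ?D (Hs n)" "\<And>n. resolvent_integral (f n) \<le> \<Gamma> + (\<epsilon> n)\<^sup>2 / 8"
    using near[of "{}"] by auto
  have [measurable]: "f n \<in> borel_measurable M" for n using Dm[OF f(1)] .
  have fnn: "0 \<le> f n x" for n x using Dn[OF f(1)] .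
  define p where "p n x = 1 / (1 + f n x)" for n x
  have [measurable]: "p n \<in> borel_measurable M" for n unfolding p_def by measurable
  have pi: "integrable M (p n)" for n unfolding p_def using fnn by (intro resolvent_integrable) auto
  have p01: "0 < p n x" "p n x \<le> 1" for n x
    using fnn[of n x] by (auto simp: p_def divide_le_eq add_pos_nonneg)
  have "AE x in M. summable (\<lambda>n. \<bar>p (Suc n) x - p n x\<bar>)"
  proof (rule AE_summable_of_summable_integrals)
    show "summable (\<lambda>n. \<integral>x. \<bar>p (Suc n) x - p n x\<bar> \<partial>M)"
    proof (rule summable_comparison_test'[OF sum_e])
      fix n
      have "(\<integral>x. \<bar>1 / (1 + f (Suc n) x) - 1 / (1 + f n x)\<bar> \<partial>M) \<le> \<epsilon> n"
      proof (rule close)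
        show "f (Suc n) \<in> ?D (Hs n)" using f(1) Dmono[OF Hs_mono[of n "Suc n"]] by auto
        have "(\<epsilon> (Suc n))\<^sup>2 \<le> (\<epsilon> n)\<^sup>2" using e_mono[of n "Suc n"] e by (intro power_mono) (auto intro: less_imp_le)
        then show "resolvent_integral (f (Suc n)) \<le> \<Gamma> + (\<epsilon> n)\<^sup>2 / 8" using f(2)[of "Suc n"] by simp
      qed (use f in auto)
      then show "norm (\<integral>x. \<bar>p (Suc n) x - p n x\<bar> \<partial>M) \<le> \<epsilon> n" by (simp add: p_def)
    qed
  qed (use pi in auto)
  then have conv: "AE x in M. convergent (\<lambda>n. p n x)"
  proof eventually_elim
    case (elim x)
    then have "summable (\<lambda>n. p (Suc n) x - p n x)" by (rule summable_rabs_cancel)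
    then have "convergent (\<lambda>n. \<Sum>k<n. p (Suc k) x - p k x)" by (simp add: summable_iff_convergent)
    then have "convergent (\<lambda>n. p n x - p 0 x)" by (simp add: sum_lessThan_telescope[of "\<lambda>k. p k x"])
    then have "convergent (\<lambda>n. (p n x - p 0 x) + p 0 x)" by (intro convergent_add convergent_const)
    then show ?case by simp
  qed
  define q where "q x = lim (\<lambda>n. p n x)" for x
  have [measurable]: "q \<in> borel_measurable M" unfolding q_def by measurable
  have pq: "AE x in M. (\<lambda>n. p n x) \<longlonglongrightarrow> q x"
    using conv by eventually_elim (simp add: q_def convergent_LIMSEQ_iff)
  have "(\<integral>\<^sup>+x. liminf (\<lambda>n. ennreal (f n x)) \<partial>M) \<le> liminf (\<lambda>n. \<integral>\<^sup>+x. ennreal (f n x) \<partial>M)"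
    by (intro nn_integral_liminf) measurable
  also have "(\<integral>\<^sup>+x. ennreal (f n x) \<partial>M) = 1" for n
    using entropy_ballD[OF Dball[OF f(1)[of n]]] by (subst nn_integral_eq_integral) auto
  then have "liminf (\<lambda>n. \<integral>\<^sup>+x. ennreal (f n x) \<partial>M) = 1" by (simp add: Liminf_const)
  finally have "(\<integral>\<^sup>+x. liminf (\<lambda>n. ennreal (f n x)) \<partial>M) \<noteq> \<infinity>" by (auto simp: top_unique)
  then have fin: "AE x in M. liminf (\<lambda>n. ennreal (f n x)) \<noteq> \<infinity>"
    by (intro nn_integral_PInf_AE) measurable
  \<comment> \<open>Where \<open>q\<close> vanishes, the densities tend to infinity; Fatou's lemma excludes this outside a
    null set.\<close>
  have qpos: "AE x in M. 0 < q x"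
    using fin pq
  proof eventually_elim
    case (elim x)
    have "0 \<le> q x" using LIMSEQ_le_const[OF elim(2)] p01 by (meson less_imp_le)
    moreover have "q x \<noteq> 0"
    proof
      assume q0: "q x = 0"
      have K: "ennreal K \<le> liminf (\<lambda>n. ennreal (f n x))" for K
      proof (rule Liminf_bounded)
        have "0 < 1 / (1 + \<bar>K\<bar>)" by (simp add: add_pos_nonneg)
        then have "\<forall>\<^sub>F n in sequentially. p n x < 1 / (1 + \<bar>K\<bar>)"
          using order_tendstoD(2)[OF elim(2)] q0 by simp
        then show "\<forall>\<^sub>F n in sequentially. ennreal K \<le> ennreal (f n x)"
        proof eventually_elim
          case (elim n)
          then have "1 + \<bar>K\<bar> < 1 + f n x" using fnn[of n x]
            by (simp add: p_def divide_simps add_pos_nonneg split: if_splits)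
          then show ?case by (intro ennreal_leI) simp
        qed
      qed
      show False
      proof (cases "liminf (\<lambda>n. ennreal (f n x))")
        case (real r)
        then show False using K[of "r + 1"] by (simp add: ennreal_le_iff)
      next
        case top
        then show False using elim(1) by simp
      qed
    qed
    ultimately show ?case by simp
  qed
  define h where "h x = max 0 (1 / q x - 1)" for x
  have [measurable]: "h \<in> borel_measurable M" unfolding h_def by measurable
  have hnn: "0 \<le> h x" for x by (simp add: h_def)

  have lim_h: "AE x in M. (\<lambda>n. f' n x) \<longlonglongrightarrow> h x"
    if f': "\<And>n. f' n \<in> ?D (Hs n)" "\<And>n. resolvent_integral (f' n) \<le> \<Gamma> + (\<epsilon> n)\<^sup>2 / 8" for f'
  proof -
    have [measurable]: "f' n \<in> borel_measurable M" for n using Dm[OF f'(1)] .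
    have f'nn: "0 \<le> f' n x" for n x using Dn[OF f'(1)] .
    have pi': "integrable M (\<lambda>x. 1 / (1 + f' n x))" for n using f'nn by (intro resolvent_integrable) auto
    have "AE x in M. summable (\<lambda>n. \<bar>1 / (1 + f' n x) - p n x\<bar>)"
    proof (rule AE_summable_of_summable_integrals)
      show "summable (\<lambda>n. \<integral>x. \<bar>1 / (1 + f' n x) - p n x\<bar> \<partial>M)"
      proof (rule summable_comparison_test'[OF sum_e])
        fix n
        have "(\<integral>x. \<bar>1 / (1 + f' n x) - 1 / (1 + f n x)\<bar> \<partial>M) \<le> \<epsilon> n"
          by (rule close) (use f f' in auto)
        then show "norm (\<integral>x. \<bar>1 / (1 + f' n x) - p n x\<bar> \<partial>M) \<le> \<epsilon> n" by (simp add: p_def)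
      qed
    qed (use pi pi' in auto)
    then show ?thesis using pq qpos
    proof eventually_elim
      case (elim x)
      have "(\<lambda>n. \<bar>1 / (1 + f' n x) - p n x\<bar>) \<longlonglongrightarrow> 0" by (rule summable_LIMSEQ_zero[OF elim(1)])
      then have "(\<lambda>n. 1 / (1 + f' n x) - p n x) \<longlonglongrightarrow> 0" by (simp add: tendsto_rabs_zero_iff)
      from tendsto_add[OF this elim(2)] have *: "(\<lambda>n. 1 / (1 + f' n x)) \<longlonglongrightarrow> q x" by simp
      have "(\<lambda>n. 1 / (1 / (1 + f' n x)) - 1) \<longlonglongrightarrow> 1 / q x - 1"
        by (intro tendsto_intros *) (use elim in auto)
      moreover have "1 / (1 / (1 + f' n x)) - 1 = f' n x" for n by simp
      ultimately have l: "(\<lambda>n. f' n x) \<longlonglongrightarrow> 1 / q x - 1" by simp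
      moreover have "0 \<le> 1 / q x - 1" using LIMSEQ_le_const[OF l] f'nn by blast
      ultimately show ?case by (simp add: h_def max_absorb2)
    qed
  qed
  have hball: "h \<in> entropy_ball M L"
    by (rule entropy_ball_closed[OF Dball[OF f(1)] L lim_h[OF f]]) (use hnn in auto)
  have "(\<integral>x. g x * h x \<partial>M) \<le> a" if ga: "(g, a) \<in> \<H>" for g a
  proof -
    obtain f' where f': "\<And>n. f' n \<in> ?D (Hs n \<union> {(g, a)})" "\<And>n. resolvent_integral (f' n) \<le> \<Gamma> + (\<epsilon> n)\<^sup>2 / 8"
      using near[of "{(g, a)}"] ga by auto
    have f'D: "f' n \<in> ?D (Hs n)" for n using f'(1)[of n] Dmono[of "Hs n" "Hs n \<union> {(g, a)}"] by auto
    note F = entropy_ballD[OF Dball[OF f'D]]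
    show ?thesis
    proof (rule entropy_bounded_closed_halfspace[OF F(1) F(2) F(4) lim_h[OF f'D f'(2)] _ _ H[OF ga] _ L])
      show "(\<integral>x. g x * f' n x \<partial>M) \<le> a" for n
        using f'(1)[of n] by (auto simp: ball_constrained_def)
    qed (use hnn in auto)
  qed
  then show ?thesis using hball by (auto simp: ball_constrained_def)
qed

end

section \<open>Relative entropy in terms of densities\<close>

text \<open>Integrating \<open>f ln\<^sup>+ f + 1 = k(f) + f + f ln\<^sup>- f\<close>, where \<open>k\<close> is the entropy integrand, relates the
  two parts of the entropy to \<open>\<integral>k(f)\<close> inside the extended nonnegative reals. The negative part is at
  most 1 because \<open>- y ln y \<le> 1\<close>, so it may be subtracted.\<close>

lemma (in prob_space) relative_entropy_density:
  assumes [measurable]: "f \<in> borel_measurable M" and nn: "\<And>x. 0 \<le> f x"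
    and one: "(\<integral>\<^sup>+x. ennreal (f x) \<partial>M) = 1"
  shows "relative_entropy (density M f) M = enn2ereal (\<integral>\<^sup>+x. ennreal (entropy_integrand (f x)) \<partial>M)"
proof -
  let ?N = "density M (\<lambda>x. ennreal (f x))"
  let ?E = "entropy_density (exp 1) M ?N"
  let ?a = "\<integral>\<^sup>+x. ennreal (f x) * ennreal (ln (f x)) \<partial>M"
  let ?b = "\<integral>\<^sup>+x. ennreal (f x) * ennreal (- ln (f x)) \<partial>M"
  let ?K = "\<integral>\<^sup>+x. ennreal (entropy_integrand (f x)) \<partial>M"
  have ac: "absolutely_continuous M ?N" by (intro absolutely_continuousI_density) measurable
  have "AE x in M. ennreal (f x) = RN_deriv M ?N x"
    by (rule RN_deriv_unique) auto
  then have E: "AE x in M. ?E x = ln (f x)"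
  proof eventually_elim
    case (elim x)
    then have "enn2real (RN_deriv M ?N x) = f x" by (simp add: nn flip: elim)
    then show ?case by (simp add: entropy_density_def log_def)
  qed
  have pos: "(\<integral>\<^sup>+x. ennreal (?E x) \<partial>?N) = ?a"
    by (subst nn_integral_density) (use E in \<open>auto intro!: nn_integral_cong_AE elim!: eventually_mono\<close>)
  have neg: "(\<integral>\<^sup>+x. ennreal (- ?E x) \<partial>?N) = ?b"
    by (subst nn_integral_density) (use E in \<open>auto intro!: nn_integral_cong_AE elim!: eventually_mono\<close>)
  have b_le: "ennreal y * ennreal (- ln y) \<le> 1" if "0 \<le> y" for y
  proof -
    have "- (y * ln y) \<le> 1" using entropy_integrand_nonneg[OF that] that by (simp add: entropy_integrand_def)
    then show ?thesis using that by (simp add: ennreal_mult'[symmetric] ennreal_le_1)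
  qed
  have "?b \<le> (\<integral>\<^sup>+x. 1 \<partial>M)" by (intro nn_integral_mono b_le nn)
  then have b: "?b \<le> 1" by (simp add: emeasure_space_1)
  have pw: "ennreal y * ennreal (ln y) + 1 = ennreal (entropy_integrand y) + ennreal y + ennreal y * ennreal (- ln y)"
    if y: "0 \<le> y" for y
  proof (cases "0 \<le> ln y")
    case True
    then have "ennreal y * ennreal (ln y) + 1 = ennreal (y * ln y + 1)"
      using y by (simp add: ennreal_mult)
    also have "\<dots> = ennreal (entropy_integrand y + y)" by (simp add: entropy_integrand_def)
    also have "\<dots> = ennreal (entropy_integrand y) + ennreal y"
      using y by (simp add: entropy_integrand_nonneg)
    finally show ?thesis using True by (simp add: ennreal_neg)
  next
    case False
    then have "ennreal (entropy_integrand y) + ennreal y + ennreal y * ennreal (- ln y)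
        = ennreal (entropy_integrand y + y + y * (- ln y))"
      using y by (subst ennreal_mult[symmetric]) (auto simp: entropy_integrand_nonneg mult_nonneg_nonpos simp flip: ennreal_plus)
    also have "\<dots> = 1" by (simp add: entropy_integrand_def)
    finally show ?thesis using False by (simp add: ennreal_neg)
  qed
  have "?a + 1 = (\<integral>\<^sup>+x. ennreal (f x) * ennreal (ln (f x)) + 1 \<partial>M)"
    by (simp add: nn_integral_add emeasure_space_1)
  also have "\<dots> = (\<integral>\<^sup>+x. ennreal (entropy_integrand (f x)) + ennreal (f x) + ennreal (f x) * ennreal (- ln (f x)) \<partial>M)"
    by (intro nn_integral_cong pw nn)
  also have "\<dots> = ?K + 1 + ?b" by (simp add: nn_integral_add one)
  finally have "1 + ?a = 1 + (?K + ?b)" by (simp add: ac_simps)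
  then have a: "?a = ?K + ?b" by (simp add: ennreal_add_left_cancel)
  have "enn2ereal ?a - enn2ereal ?b = enn2ereal ?K"
  proof -
    obtain r where r: "?b = ennreal r" "0 \<le> r" using b by (cases ?b) (auto simp: top_unique)
    show ?thesis unfolding a plus_ennreal.rep_eq unfolding r(1)
      using r(2) by (cases "enn2ereal ?K") (auto simp: enn2ereal_ennreal)
  qed
  then show ?thesis using ac pos neg by (simp add: relative_entropy_def)
qed

lemma (in prob_space) obtain_density:
  assumes N: "prob_space N" "sets N = sets M" "absolutely_continuous M N"
  obtains f where "f \<in> borel_measurable M" "\<And>x. 0 \<le> f x" "density M (\<lambda>x. ennreal (f x)) = N"
proof -
  interpret N: prob_space N by fact
  obtain D where D: "D \<in> borel_measurable M" "AE x in M. RN_deriv M N x = ennreal (D x)" "\<And>x. 0 \<le> D x"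
    using real_RN_deriv[OF N.finite_measure_axioms N(3,2)] by metis
  have "density M (\<lambda>x. ennreal (D x)) = density M (RN_deriv M N)"
    by (intro density_cong) (use D in \<open>auto elim: eventually_mono\<close>)
  also have "\<dots> = N" by (rule density_RN_deriv[OF N(3,2)])
  finally show ?thesis using that D by blast
qed

section \<open>The density of the mean conditional law\<close>

text \<open>The function \<open>f\<close> is the density of the average of the conditional laws of \<open>X\<^sub>1, \<dots>, X\<^sub>n\<close> given \<open>A\<close>.
  The conditional probability has density \<open>Z = 1\<^sub>A / P(A)\<close> and relative entropy \<open>- ln P(A)\<close> with respect
  to the original one. The Young inequality for \<open>Z\<close> and \<open>s = \<Sum>ln f(X\<^sub>i)\<close> reads
  \<open>Z s \<le> k(Z) + \<Prod>f(X\<^sub>i) - 1\<close>, with \<open>k\<close> the entropy integrand. The expectation of the product is 1 by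
  independence, and the expectation of the left side is \<open>n\<close> times the integral of \<open>f ln f\<close>. So the
  entropy of \<open>f\<close> is at most \<open>- ln P(A) / n\<close>. The second conclusion is linearity: a bound on the sample
  mean of \<open>g\<close> that holds throughout \<open>A\<close> survives averaging.\<close>

lemma (in prob_space) conditioned_mean_density:
  fixes X :: "nat \<Rightarrow> 'a \<Rightarrow> 'b"
  assumes A: "A \<in> events" "prob A > 0" and n: "1 \<le> n"
    and ind: "indep_vars (\<lambda>_. N) X {1..n}"
    and law: "\<And>i. i \<in> {1..n} \<Longrightarrow> distr M N (X i) = \<mu>"
  obtains f where "f \<in> entropy_ball \<mu> (- ln (prob A) / n)"
    "\<And>g a. all_exponential_moments \<mu> g \<Longrightarrow> (\<And>\<omega>. \<omega> \<in> A \<Longrightarrow> (\<Sum>i=1..n. g (X i \<omega>)) / n \<le> a) \<Longrightarrow>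
        (\<integral>x. g x * f x \<partial>\<mu>) \<le> a"
proof -
  define p where "p = prob A"
  have p: "0 < p" "p \<le> 1" using A by (auto simp: p_def)
  have X [measurable]: "i \<in> {1..n} \<Longrightarrow> random_variable N (X i)" for i
    using ind by (auto simp: indep_vars_def)
  have sets_\<mu> [measurable_cong, simp]: "sets \<mu> = sets N" using law[of 1] n by auto
  interpret \<mu>: prob_space \<mu> using law[of 1] n X[of 1] by (auto intro: prob_space_distr)
  note [measurable] = A(1)
  define Z where "Z \<omega> = indicator A \<omega> / p" for \<omega>
  have [measurable]: "Z \<in> borel_measurable M" unfolding Z_def by measurable
  have Znn: "0 \<le> Z \<omega>" for \<omega> using p by (simp add: Z_def)
  have Zi: "integrable M Z"
    by (rule integrable_const_bound[where B="1 / p"]) (use p in \<open>auto simp: Z_def indicator_def\<close>)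
  have EZ: "(\<integral>\<omega>. Z \<omega> \<partial>M) = 1"
    using p A by (simp add: Z_def p_def[symmetric])
  define Q where "Q = density M (\<lambda>\<omega>. ennreal (Z \<omega>))"
  have setsQ [measurable_cong, simp]: "sets Q = sets M" "space Q = space M" by (auto simp: Q_def)
  have "emeasure Q (space Q) = 1"
    using EZ Zi Znn by (simp add: Q_def emeasure_density nn_integral_eq_integral cong: nn_integral_cong)
  then interpret Q: prob_space Q by (intro prob_spaceI)
  define \<nu> where "\<nu> i = distr Q N (X i)" for i
  have prob_\<nu>: "prob_space (\<nu> i)" if "i \<in> {1..n}" for i
    unfolding \<nu>_def using X[OF that] by (intro Q.prob_space_distr) simp
  have "\<exists>f. f \<in> borel_measurable \<mu> \<and> (\<forall>x. 0 \<le> f x) \<and> density \<mu> (\<lambda>x. ennreal (f x)) = \<nu> i"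
    if i: "i \<in> {1..n}" for i
  proof -
    note Xi [measurable] = X[OF i]
    have "absolutely_continuous \<mu> (\<nu> i)"
      unfolding absolutely_continuous_def
    proof
      fix B assume B: "B \<in> null_sets \<mu>"
      then have BN [measurable]: "B \<in> sets N" by auto
      have "emeasure (distr M N (X i)) B = 0" using B law[OF i] by auto
      then have "X i -` B \<inter> space M \<in> null_sets M"
        using Xi by (subst (asm) emeasure_distr) (auto intro: null_setsI)
      then have "X i -` B \<inter> space M \<in> null_sets Q"
        unfolding Q_def by (intro absolutely_continuousI_density[unfolded absolutely_continuous_def, THEN subsetD]) auto
      then have "emeasure Q (X i -` B \<inter> space Q) = 0" by auto
      then show "B \<in> null_sets (\<nu> i)"
        unfolding \<nu>_def by (intro null_setsI) (auto simp: emeasure_distr)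
    qed
    then show ?thesis using \<mu>.obtain_density[OF prob_\<nu>[OF i]] by (metis \<nu>_def sets_\<mu> sets_distr)
  qed
  then obtain f0 where f0: "\<And>i. i \<in> {1..n} \<Longrightarrow> f0 i \<in> borel_measurable \<mu>"
     "\<And>i x. i \<in> {1..n} \<Longrightarrow> 0 \<le> f0 i x" "\<And>i. i \<in> {1..n} \<Longrightarrow> density \<mu> (\<lambda>x. ennreal (f0 i x)) = \<nu> i"
    by metis
  have transfer: "integrable \<mu> (\<lambda>x. f0 i x * g x) \<longleftrightarrow> integrable M (\<lambda>\<omega>. Z \<omega> * g (X i \<omega>))"
    "(\<integral>x. f0 i x * g x \<partial>\<mu>) = (\<integral>\<omega>. Z \<omega> * g (X i \<omega>) \<partial>M)"
    if i: "i \<in> {1..n}" and g[measurable]: "g \<in> borel_measurable N" for i and g :: "'b \<Rightarrow> real"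
  proof -
    note [measurable] = X[OF i] f0(1)[OF i]
    have g': "g \<in> borel_measurable \<mu>" by simp
    have "integrable \<mu> (\<lambda>x. f0 i x * g x) \<longleftrightarrow> integrable (\<nu> i) g"
      unfolding f0(3)[OF i, symmetric] by (subst integrable_density) (auto simp: f0(2)[OF i])
    also have "\<dots> \<longleftrightarrow> integrable Q (\<lambda>\<omega>. g (X i \<omega>))"
      unfolding \<nu>_def by (subst integrable_distr_eq) auto
    also have "\<dots> \<longleftrightarrow> integrable M (\<lambda>\<omega>. Z \<omega> * g (X i \<omega>))"
      unfolding Q_def by (subst integrable_density) (auto simp: Znn)
    finally show "integrable \<mu> (\<lambda>x. f0 i x * g x) \<longleftrightarrow> integrable M (\<lambda>\<omega>. Z \<omega> * g (X i \<omega>))" .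
    have "(\<integral>x. f0 i x * g x \<partial>\<mu>) = integral\<^sup>L (\<nu> i) g"
      unfolding f0(3)[OF i, symmetric] by (subst integral_density) (auto simp: f0(2)[OF i])
    also have "\<dots> = (\<integral>\<omega>. g (X i \<omega>) \<partial>Q)"
      unfolding \<nu>_def by (subst integral_distr) auto
    also have "\<dots> = (\<integral>\<omega>. Z \<omega> * g (X i \<omega>) \<partial>M)"
      unfolding Q_def by (subst integral_density) (auto simp: Znn)
    finally show "(\<integral>x. f0 i x * g x \<partial>\<mu>) = (\<integral>\<omega>. Z \<omega> * g (X i \<omega>) \<partial>M)" .
  qed
  have f0i: "integrable \<mu> (f0 i)" "(\<integral>x. f0 i x \<partial>\<mu>) = 1" if i: "i \<in> {1..n}" for i
    using transfer[OF i, of "\<lambda>_. 1"] Zi EZ by auto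
  \<comment> \<open>Conditioning on \<open>A\<close> multiplies no probability by more than \<open>1 / p\<close>. The resulting boundedness of
    \<open>f\<close> makes \<open>f ln f\<close> integrable before its entropy has been estimated.\<close>
  have f0_le: "AE x in \<mu>. f0 i x \<le> 1 / p" if i: "i \<in> {1..n}" for i
  proof -
    note [measurable] = X[OF i] f0(1)[OF i]
    define B where "B = {x \<in> space N. 1 / p < f0 i x}"
    have BN [measurable]: "B \<in> sets N"
      unfolding B_def sets_eq_imp_space_eq[OF sets_\<mu>, symmetric] sets_\<mu>[symmetric] by measurable
    let ?I = "indicator B :: 'b \<Rightarrow> real"
    have XI: "integrable M (\<lambda>\<omega>. ?I (X i \<omega>))"
      by (rule integrable_const_bound[where B=1]) (auto simp: indicator_def)
    have ZI: "integrable M (\<lambda>\<omega>. Z \<omega> * ?I (X i \<omega>))"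
      by (rule Bochner_Integration.integrable_bound[OF Zi]) (auto simp: indicator_def)
    have I1: "integrable \<mu> (\<lambda>x. f0 i x * ?I x)"
      using transfer(1)[OF i, of ?I] ZI by simp
    have I2: "integrable \<mu> ?I" by (intro \<mu>.integrable_const_bound[where B=1]) (auto simp: indicator_def)
    have "(\<integral>x. f0 i x * ?I x \<partial>\<mu>) = (\<integral>\<omega>. Z \<omega> * ?I (X i \<omega>) \<partial>M)"
      using transfer(2)[OF i, of ?I] by simp
    also have "\<dots> \<le> (\<integral>\<omega>. 1 / p * ?I (X i \<omega>) \<partial>M)"
      using p by (intro integral_mono ZI integrable_mult_right XI) (auto simp: Z_def indicator_def)
    also have "\<dots> = 1 / p * (\<integral>\<omega>. ?I (X i \<omega>) \<partial>M)" by (rule integral_mult_right_zero)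
    also have "(\<integral>\<omega>. ?I (X i \<omega>) \<partial>M) = (\<integral>x. ?I x \<partial>\<mu>)"
      unfolding law[OF i, symmetric] by (subst integral_distr) auto
    finally have le: "(\<integral>x. (f0 i x - 1 / p) * ?I x \<partial>\<mu>) \<le> 0"
      using I1 I2 by (simp add: left_diff_distrib)
    have nn: "0 \<le> (f0 i x - 1 / p) * ?I x" for x by (auto simp: indicator_def B_def)
    have int: "integrable \<mu> (\<lambda>x. (f0 i x - 1 / p) * ?I x)"
      using I1 I2 by (simp add: left_diff_distrib)
    have "(\<integral>x. (f0 i x - 1 / p) * ?I x \<partial>\<mu>) = 0"
      using le integral_nonneg_AE[of "\<lambda>x. (f0 i x - 1 / p) * ?I x" \<mu>] nn by (simp add: order.antisym)
    then have "AE x in \<mu>. (f0 i x - 1 / p) * ?I x = 0"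
      using integral_nonneg_eq_0_iff_AE[OF int] nn by simp
    moreover have "AE x in \<mu>. x \<in> space N"
      using AE_space[of \<mu>] by (simp add: sets_eq_imp_space_eq[OF sets_\<mu>])
    ultimately show ?thesis
    proof eventually_elim
      case (elim x)
      then show ?case by (cases "x \<in> B") (auto simp: B_def)
    qed
  qed
  define f where "f x = (\<Sum>i=1..n. f0 i x) / n" for x
  have nf: "(\<Sum>i=1..n. f0 i x) = n * f x" for x using n by (simp add: f_def)
  have f0_le_nf: "f0 i x \<le> n * f x" if "i \<in> {1..n}" for i x
    unfolding nf[symmetric] using that f0(2) by (intro member_le_sum) auto
  have [measurable]: "f \<in> borel_measurable \<mu>" unfolding f_def using f0(1) by measurable
  then have [measurable]: "f \<in> borel_measurable N" by simp
  have fnn: "0 \<le> f x" for x unfolding f_def using f0(2) by (intro divide_nonneg_nonneg sum_nonneg) auto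
  have fi: "integrable \<mu> f" "(\<integral>x. f x \<partial>\<mu>) = 1"
  proof -
    show "integrable \<mu> f" unfolding f_def
      by (intro integrable_divide Bochner_Integration.integrable_sum f0i)
    show "(\<integral>x. f x \<partial>\<mu>) = 1" unfolding f_def
      using n f0i by (simp add: Bochner_Integration.integral_sum del: atLeastAtMost_iff One_nat_def)
  qed
  have f_le: "AE x in \<mu>. f x \<le> 1 / p"
  proof -
    have "AE x in \<mu>. \<forall>i\<in>{1..n}. f0 i x \<le> 1 / p" using f0_le by (intro AE_finite_allI) auto
    then show ?thesis
    proof eventually_elim
      case (elim x)
      have "n * f x \<le> (\<Sum>i=1..n. 1 / p)" unfolding nf[symmetric] using elim by (intro sum_mono) auto
      then have "n * f x \<le> n * (1 / p)" by simp
      then show ?case using n by (subst (asm) mult_le_cancel_left_pos) auto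
    qed
  qed
  have xlnx_bound: "\<bar>y * ln y\<bar> \<le> 1 + (1 / p)\<^sup>2" if y: "0 \<le> y" "y \<le> 1 / p" for y
  proof -
    have "y * ln y \<le> y * y" using y by (cases "y = 0") (auto intro!: mult_left_mono ln_bound)
    also have "y * y \<le> (1 / p)\<^sup>2" using power_mono[OF y(2,1), of 2] by (simp only: power2_eq_square)
    finally have "y * ln y \<le> (1 / p)\<^sup>2" .
    moreover have "- (y * ln y) \<le> 1" using entropy_integrand_nonneg[OF y(1)] y by (simp add: entropy_integrand_def)
    moreover have "0 \<le> (1 / p)\<^sup>2" by simp
    ultimately show ?thesis by linarith
  qed
  have flnf: "integrable \<mu> (\<lambda>x. f x * ln (f x))"
    by (rule \<mu>.integrable_const_bound[where B="1 + (1 / p)\<^sup>2"])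
      (use f_le in \<open>auto elim!: eventually_mono intro!: xlnx_bound fnn\<close>)
  have f0lnf: "integrable \<mu> (\<lambda>x. f0 i x * ln (f x))" if i: "i \<in> {1..n}" for i
  proof (rule Bochner_Integration.integrable_bound)
    show "integrable \<mu> (\<lambda>x. n * (f x * ln (f x)))" using flnf by simp
    show "(\<lambda>x. f0 i x * ln (f x)) \<in> borel_measurable \<mu>" using f0(1)[OF i] by measurable
    show "AE x in \<mu>. norm (f0 i x * ln (f x)) \<le> norm (n * (f x * ln (f x)))"
      using f0_le_nf[OF i] f0(2)[OF i] fnn
      by (intro AE_I2) (auto simp: abs_mult mult.assoc[symmetric] intro!: mult_right_mono)
  qed
  have ZlnX: "integrable M (\<lambda>\<omega>. Z \<omega> * ln (f (X i \<omega>)))"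
    "(\<integral>\<omega>. Z \<omega> * ln (f (X i \<omega>)) \<partial>M) = (\<integral>x. f0 i x * ln (f x) \<partial>\<mu>)" if i: "i \<in> {1..n}" for i
    using transfer[OF i, of "\<lambda>x. ln (f x)"] f0lnf[OF i] by auto
  have "(\<integral>\<omega>. (\<Sum>i=1..n. Z \<omega> * ln (f (X i \<omega>))) \<partial>M) = (\<Sum>i=1..n. \<integral>x. f0 i x * ln (f x) \<partial>\<mu>)"
    using ZlnX by (subst Bochner_Integration.integral_sum) auto
  also have "\<dots> = (\<integral>x. (\<Sum>i=1..n. f0 i x * ln (f x)) \<partial>\<mu>)"
    using f0lnf by (subst Bochner_Integration.integral_sum) auto
  also have "\<dots> = (\<integral>x. n * (f x * ln (f x)) \<partial>\<mu>)"
    by (simp only: sum_distrib_right[symmetric] nf mult.assoc)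
  also have "\<dots> = n * (\<integral>x. f x * ln (f x) \<partial>\<mu>)" by simp
  finally have lhs: "(\<integral>\<omega>. (\<Sum>i=1..n. Z \<omega> * ln (f (X i \<omega>))) \<partial>M) = n * (\<integral>x. f x * ln (f x) \<partial>\<mu>)" .

  have indf: "indep_vars (\<lambda>_. borel) (\<lambda>i \<omega>. f (X i \<omega>)) {1..n}"
    by (rule indep_vars_compose2[OF ind]) simp
  have fXi: "integrable M (\<lambda>\<omega>. f (X i \<omega>))" "(\<integral>\<omega>. f (X i \<omega>) \<partial>M) = 1" if i: "i \<in> {1..n}" for i
    using fi X[OF i] unfolding law[OF i, symmetric] by (auto simp: integrable_distr_eq integral_distr)
  have prodI: "integrable M (\<lambda>\<omega>. \<Prod>i=1..n. f (X i \<omega>))" "(\<integral>\<omega>. (\<Prod>i=1..n. f (X i \<omega>)) \<partial>M) = 1"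
    using indep_vars_integrable[OF _ indf] indep_vars_lebesgue_integral[OF _ indf] fXi by auto
  have kZ: "entropy_integrand (Z \<omega>) = (- ln p - 1) * Z \<omega> + 1" for \<omega>
    using p by (auto simp: Z_def entropy_integrand_def indicator_def ln_div algebra_simps add_divide_distrib diff_divide_distrib)
  have kZI: "integrable M (\<lambda>\<omega>. entropy_integrand (Z \<omega>))" "(\<integral>\<omega>. entropy_integrand (Z \<omega>) \<partial>M) = - ln p"
    unfolding kZ using Zi EZ by (auto simp: prob_space)
  \<comment> \<open>Where \<open>f\<close> vanishes, \<open>ln (f x) = 0\<close> is a default value, and \<open>exp (ln (f x))\<close> is not \<open>f x\<close>. On \<open>A\<close>
    this happens with probability zero.\<close>
  have pos: "AE \<omega> in M. \<forall>i\<in>{1..n}. 0 < Z \<omega> \<longrightarrow> 0 < f (X i \<omega>)"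
  proof (rule AE_finite_allI)
    fix i assume i: "i \<in> {1..n}"
    note [measurable] = X[OF i] f0(1)[OF i]
    have "AE x in \<nu> i. 0 < f x"
      unfolding f0(3)[OF i, symmetric]
    proof (subst AE_density)
      have "0 < f x" if "0 < f0 i x" for x
        using f0_le_nf[OF i, of x] that n by (metis fnn less_le mult_zero_right not_le)
      then show "AE x in \<mu>. 0 < ennreal (f0 i x) \<longrightarrow> 0 < f x" by (intro AE_I2) simp
    qed simp
    then have "AE \<omega> in Q. 0 < f (X i \<omega>)"
      unfolding \<nu>_def by (subst (asm) AE_distr_iff) auto
    then show "AE \<omega> in M. 0 < Z \<omega> \<longrightarrow> 0 < f (X i \<omega>)"
      unfolding Q_def by (subst (asm) AE_density) auto
  qed simp
  have "(\<integral>\<omega>. (\<Sum>i=1..n. Z \<omega> * ln (f (X i \<omega>))) \<partial>M)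
      \<le> (\<integral>\<omega>. entropy_integrand (Z \<omega>) + (\<Prod>i=1..n. f (X i \<omega>)) - 1 \<partial>M)"
  proof (rule integral_mono_AE)
    show "integrable M (\<lambda>\<omega>. \<Sum>i=1..n. Z \<omega> * ln (f (X i \<omega>)))" using ZlnX by auto
    show "integrable M (\<lambda>\<omega>. entropy_integrand (Z \<omega>) + (\<Prod>i=1..n. f (X i \<omega>)) - 1)"
      using kZI prodI by auto
    show "AE \<omega> in M. (\<Sum>i=1..n. Z \<omega> * ln (f (X i \<omega>))) \<le> entropy_integrand (Z \<omega>) + (\<Prod>i=1..n. f (X i \<omega>)) - 1"
      using pos
    proof eventually_elim
      case (elim \<omega>)
      show ?case
      proof (cases "Z \<omega> = 0")
        case True
        then show ?thesis using fnn by (simp add: entropy_integrand_def prod_nonneg)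
      next
        case False
        then have f_pos: "0 < f (X i \<omega>)" if "i \<in> {1..n}" for i using elim that Znn[of \<omega>] by auto
        then have "exp (\<Sum>i=1..n. ln (f (X i \<omega>))) = (\<Prod>i=1..n. f (X i \<omega>))"
          by (subst exp_sum) (auto intro!: prod.cong)
        then show ?thesis
          using entropy_young[OF Znn, of \<omega> "\<Sum>i=1..n. ln (f (X i \<omega>))"] by (simp add: sum_distrib_left)
      qed
    qed
  qed
  also have "\<dots> = - ln p"
    using kZI prodI by (simp add: prob_space)
  finally have ent: "(\<integral>x. f x * ln (f x) \<partial>\<mu>) \<le> - ln p / n"
    unfolding lhs using n by (simp add: field_simps)
  have kf: "integrable \<mu> (\<lambda>x. entropy_integrand (f x))"
    "(\<integral>x. entropy_integrand (f x) \<partial>\<mu>) = (\<integral>x. f x * ln (f x) \<partial>\<mu>)"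
    unfolding entropy_integrand_def using flnf fi by (auto simp: \<mu>.prob_space)
  have ball: "f \<in> entropy_ball \<mu> (- ln p / n)"
    unfolding entropy_ball_def using fnn fi ent kf
    by (auto simp: nn_integral_eq_integral entropy_integrand_nonneg intro!: ennreal_leI)
  moreover have "(\<integral>x. g x * f x \<partial>\<mu>) \<le> a"
    if g: "all_exponential_moments \<mu> g" and ga: "\<And>\<omega>. \<omega> \<in> A \<Longrightarrow> (\<Sum>i=1..n. g (X i \<omega>)) / n \<le> a" for g a
  proof -
    have [measurable]: "g \<in> borel_measurable \<mu>" using g by (simp add: all_exponential_moments_def)
    then have gN: "g \<in> borel_measurable N" by simp
    have gf: "integrable \<mu> (\<lambda>x. g x * f x)" by (rule \<mu>.entropy_ball_integrable_mult[OF ball g])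
    have gf0: "integrable \<mu> (\<lambda>x. f0 i x * g x)" if i: "i \<in> {1..n}" for i
    proof (rule Bochner_Integration.integrable_bound)
      show "integrable \<mu> (\<lambda>x. n * (g x * f x))" using gf by simp
      show "(\<lambda>x. f0 i x * g x) \<in> borel_measurable \<mu>" using f0(1)[OF i] by measurable
      show "AE x in \<mu>. norm (f0 i x * g x) \<le> norm (n * (g x * f x))"
      proof (intro AE_I2)
        fix x
        have "\<bar>g x\<bar> * f0 i x \<le> \<bar>g x\<bar> * (n * f x)" by (intro mult_left_mono f0_le_nf[OF i]) simp
        then show "norm (f0 i x * g x) \<le> norm (n * (g x * f x))"
          using f0(2)[OF i, of x] fnn[of x] by (simp add: abs_mult mult_ac)
      qed
    qed
    have ZgX: "integrable M (\<lambda>\<omega>. Z \<omega> * g (X i \<omega>))"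
      "(\<integral>x. f0 i x * g x \<partial>\<mu>) = (\<integral>\<omega>. Z \<omega> * g (X i \<omega>) \<partial>M)" if i: "i \<in> {1..n}" for i
      using transfer[OF i gN] gf0[OF i] by auto
    have "n * (\<integral>x. g x * f x \<partial>\<mu>) = (\<integral>x. g x * (n * f x) \<partial>\<mu>)" by (simp add: mult.left_commute)
    also have "\<dots> = (\<integral>x. (\<Sum>i=1..n. f0 i x * g x) \<partial>\<mu>)"
      unfolding nf[symmetric] by (simp only: sum_distrib_left mult.commute)
    also have "\<dots> = (\<Sum>i=1..n. \<integral>\<omega>. Z \<omega> * g (X i \<omega>) \<partial>M)"
      using gf0 ZgX by (subst Bochner_Integration.integral_sum) auto
    also have "\<dots> = (\<integral>\<omega>. (\<Sum>i=1..n. Z \<omega> * g (X i \<omega>)) \<partial>M)"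
      using ZgX by (subst Bochner_Integration.integral_sum) auto
    also have "\<dots> \<le> (\<integral>\<omega>. (n * a) * Z \<omega> \<partial>M)"
    proof (rule integral_mono)
      show "integrable M (\<lambda>\<omega>. \<Sum>i=1..n. Z \<omega> * g (X i \<omega>))" using ZgX by auto
      show "integrable M (\<lambda>\<omega>. (n * a) * Z \<omega>)" using Zi by auto
      fix \<omega>
      show "(\<Sum>i=1..n. Z \<omega> * g (X i \<omega>)) \<le> (n * a) * Z \<omega>"
      proof (cases "\<omega> \<in> A")
        case True
        then have "(\<Sum>i=1..n. g (X i \<omega>)) \<le> n * a" using ga[OF True] n by (simp add: divide_le_eq mult.commute)
        then have "Z \<omega> * (\<Sum>i=1..n. g (X i \<omega>)) \<le> Z \<omega> * (n * a)" by (intro mult_left_mono Znn)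
        then show ?thesis by (simp add: sum_distrib_left mult.commute)
      qed (simp add: Z_def)
    qed
    also have "\<dots> = n * a" using EZ by simp
    finally show ?thesis using n by simp
  qed
  ultimately show ?thesis using that by (auto simp: p_def)
qed

section \<open>Empirical measures\<close>

text \<open>As an image of the uniform measure on the indices, the empirical measure inherits countable
  additivity and an integration formula.\<close>

lemma empirical_measure_eq_distr:
  assumes n: "1 \<le> n"
  shows "empirical_measure x n = distr (uniform_count_measure {1..n}) borel x"
proof -
  let ?D = "distr (uniform_count_measure {1..n}) borel x"
  have mx: "x \<in> measurable (uniform_count_measure {1..n}) borel"
    by (simp add: measurable_cong_sets[OF sets_uniform_count_measure_count_space refl])
  have "(\<Sum>i=1..n. emeasure (return borel (x i)) A) / of_nat n = emeasure ?D A" if A: "A \<in> sets borel" for A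
  proof -
    have "(\<Sum>i=1..n. emeasure (return borel (x i)) A) = (\<Sum>i=1..n. indicator A (x i))"
      using A by simp
    also have "\<dots> = of_nat (card (x -` A \<inter> {1..n}))"
      by (simp add: indicator_def sum.If_cases Int_def vimage_def conj_commute)
    also have "\<dots> / of_nat n = emeasure (uniform_count_measure {1..n}) (x -` A \<inter> {1..n})"
      using n by (subst emeasure_uniform_count_measure) (auto simp: ennreal_of_nat_eq_real_of_nat divide_ennreal)
    also have "\<dots> = emeasure ?D A"
      using A mx by (subst emeasure_distr) (auto simp: space_uniform_count_measure)
    finally show ?thesis .
  qed
  then have "empirical_measure x n = measure_of UNIV (sets borel) (emeasure ?D)"
    unfolding empirical_measure_def
    by (intro measure_of_eq) (auto simp: sets.sigma_sets_eq[of borel, simplified])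
  also have "\<dots> = ?D" using measure_of_of_measure[of ?D] by simp
  finally show ?thesis .
qed

lemma integral_empirical_measure:
  fixes g :: "'a::topological_space \<Rightarrow> real"
  assumes n: "1 \<le> n" and g: "g \<in> borel_measurable borel"
  shows "integrable (empirical_measure x n) g"
    "(\<integral>y. g y \<partial>empirical_measure x n) = (\<Sum>i=1..n. g (x i)) / n"
proof -
  have mx: "x \<in> measurable (uniform_count_measure {1..n}) borel"
    by (simp add: measurable_cong_sets[OF sets_uniform_count_measure_count_space refl])
  show "integrable (empirical_measure x n) g"
    unfolding empirical_measure_eq_distr[OF n] uniform_count_measure_def
    using mx g by (subst integrable_distr_eq) (auto simp: uniform_count_measure_def integrable_point_measure_finite)
  show "(\<integral>y. g y \<partial>empirical_measure x n) = (\<Sum>i=1..n. g (x i)) / n"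
    unfolding empirical_measure_eq_distr[OF n]
    by (subst integral_distr[OF mx g]) (simp add: integral_uniform_count_measure)
qed

lemma empirical_measure_probs_integrating:
  assumes n: "1 \<le> n" and F: "F \<subseteq> borel_measurable borel"
  shows "empirical_measure x n \<in> probs_integrating F"
proof -
  have mx: "x \<in> measurable (uniform_count_measure {1..n}) borel"
    by (simp add: measurable_cong_sets[OF sets_uniform_count_measure_count_space refl])
  interpret U: prob_space "uniform_count_measure {1..n}"
    using n by (intro prob_space_uniform_count_measure) auto
  have "prob_space (empirical_measure x n)"
    unfolding empirical_measure_eq_distr[OF n] by (rule U.prob_space_distr[OF mx])
  then show ?thesis
    using integral_empirical_measure(1)[OF n] F
    by (auto simp: probs_integrating_def borel_probs_def empirical_measure_eq_distr[OF n])
qed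

section \<open>Finite covers of entropy balls in the weak topology\<close>

lemma function_space_exponential_moments:
  assumes F: "function_space F" "F \<subseteq> borel_measurable borel" and \<mu>: "sets \<mu> = sets borel"
    and exp: "\<And>\<phi>. \<phi> \<in> F \<Longrightarrow> (\<integral>\<^sup>+ x. ennreal (exp (\<phi> x)) \<partial>\<mu>) < \<infinity>" and g: "g \<in> F"
  shows "all_exponential_moments \<mu> g"
  unfolding all_exponential_moments_def
proof (intro conjI allI)
  have "g \<in> borel_measurable borel" using F g by auto
  then show m [measurable]: "g \<in> borel_measurable \<mu>" using measurable_cong_sets[OF \<mu> refl] by auto
  fix s
  have "(\<lambda>x. s * g x) \<in> F" using F g by (auto simp: function_space_def)
  from exp[OF this] show "integrable \<mu> (\<lambda>x. exp (s * g x))"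
    by (intro integrableI_nonneg) auto
qed

lemma entropy_ball_density:
  fixes M :: "'a::topological_space measure"
  assumes "prob_space M" and M: "sets M = sets borel" and F: "\<And>g. g \<in> F \<Longrightarrow> all_exponential_moments M g"
    and f: "f \<in> entropy_ball M L" and L: "0 \<le> L"
  shows "density M f \<in> probs_integrating F"
    "g \<in> F \<Longrightarrow> (\<integral>x. g x \<partial>density M f) = (\<integral>x. g x * f x \<partial>M)"
    "relative_entropy (density M f) M \<le> ereal L"
proof -
  interpret prob_space M by fact
  note f = f entropy_ballD[OF f]
  have one: "(\<integral>\<^sup>+x. ennreal (f x) \<partial>M) = 1"
    using f by (subst nn_integral_eq_integral) auto
  have "prob_space (density M f)"
    using f by (intro prob_spaceI) (simp add: emeasure_density one cong: nn_integral_cong)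
  moreover have "integrable (density M f) g" if g: "g \<in> F" for g
    using entropy_ball_integrable_mult[OF f(1) F[OF g]] f F[OF g]
    by (subst integrable_density) (auto simp: all_exponential_moments_def mult.commute)
  ultimately show "density M f \<in> probs_integrating F"
    using M by (auto simp: probs_integrating_def borel_probs_def)
  show "(\<integral>x. g x \<partial>density M f) = (\<integral>x. g x * f x \<partial>M)" if g: "g \<in> F" for g
    using f F[OF g] by (subst integral_density) (auto simp: all_exponential_moments_def mult.commute)
  have "relative_entropy (density M f) M \<le> enn2ereal (ennreal L)"
    using f by (subst relative_entropy_density[OF _ _ one]) (auto simp: less_eq_ennreal.rep_eq[symmetric])
  then show "relative_entropy (density M f) M \<le> ereal L" using L by (simp add: enn2ereal_ennreal)
qed

definition open_box :: "('a::topological_space \<Rightarrow> real) set \<Rightarrow> (('a \<Rightarrow> real) \<times> real) set \<Rightarrow> 'a measure set" where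
  "open_box F H = {\<nu> \<in> probs_integrating F. \<forall>(g, a)\<in>H. a < (\<integral>x. g x \<partial>\<nu>)}"

lemma open_box_Un: "open_box F (H \<union> H') = open_box F H \<inter> open_box F H'"
  by (auto simp: open_box_def)

text \<open>Integrals lying in an interval are described by two open half-spaces, one for \<open>\<phi>\<close> and one for
  \<open>- \<phi>\<close>, so half-spaces form a subbase of the weak topology.\<close>

lemma open_box_neighbourhood:
  assumes F: "function_space F" and U: "openin (weak_topology_on_probs F) U" and \<nu>: "\<nu> \<in> U"
  shows "\<exists>H. finite H \<and> H \<subseteq> F \<times> UNIV \<and> \<nu> \<in> open_box F H \<and> open_box F H \<subseteq> U"
proof -
  let ?S = "{{\<nu> \<in> probs_integrating F. (\<integral>x. \<phi> x \<partial>\<nu>) \<in> V} | \<phi> V. \<phi> \<in> F \<and> open V}"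
  have "generate_topology_on ?S U"
    using U unfolding weak_topology_on_probs_def openin_topology_generated_by_iff .
  then show ?thesis using \<nu>
  proof (induction U)
    case (Int A B)
    then obtain H H' where "finite H" "H \<subseteq> F \<times> UNIV" "\<nu> \<in> open_box F H" "open_box F H \<subseteq> A"
      "finite H'" "H' \<subseteq> F \<times> UNIV" "\<nu> \<in> open_box F H'" "open_box F H' \<subseteq> B" by auto
    then show ?case by (intro exI[of _ "H \<union> H'"]) (auto simp: open_box_Un)
  next
    case (UN K)
    then obtain k where "k \<in> K" "\<nu> \<in> k" by auto
    then show ?case using UN.IH[of k] by blast
  next
    case (Basis W)
    then obtain \<phi> V where \<phi>: "\<phi> \<in> F" "open V" "W = {\<nu> \<in> probs_integrating F. (\<integral>x. \<phi> x \<partial>\<nu>) \<in> V}" by auto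
    then have "(\<integral>x. \<phi> x \<partial>\<nu>) \<in> V" and P: "\<nu> \<in> probs_integrating F" using Basis.prems by auto
    with \<phi>(2) obtain e where e: "e > 0" "\<And>y. \<bar>y - (\<integral>x. \<phi> x \<partial>\<nu>)\<bar> < e \<Longrightarrow> y \<in> V"
      by (auto simp: open_dist dist_real_def)
    let ?r = "\<integral>x. \<phi> x \<partial>\<nu>"
    have m: "(\<lambda>x. - \<phi> x) \<in> F"
    proof -
      have "(\<lambda>x. (-1) * \<phi> x) \<in> F" using F \<phi>(1) unfolding function_space_def by blast
      then show ?thesis by simp
    qed
    show ?case
    proof (intro exI[of _ "{(\<phi>, ?r - e), (\<lambda>x. - \<phi> x, - ?r - e)}"] conjI)
      show "\<nu> \<in> open_box F {(\<phi>, ?r - e), (\<lambda>x. - \<phi> x, - ?r - e)}" using P e by (simp add: open_box_def)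
      show "open_box F {(\<phi>, ?r - e), (\<lambda>x. - \<phi> x, - ?r - e)} \<subseteq> W"
        unfolding \<phi>(3) open_box_def by (auto intro!: e(2))
    qed (use \<phi> m in auto)
  qed simp
qed

text \<open>Compactness of the entropy ball. The topology \<open>X\<close> on its image \<open>K\<close> in the space of measures is
  generated by the traces of open half-spaces. A cover of \<open>K\<close> by such half-spaces
  without finite subcover amounts to closed half-spaces whose finite intersections meet
  \<open>K\<close> and whose total intersection does not.\<close>

lemma entropy_ball_finite_cover:
  fixes M :: "'a::topological_space measure"
  assumes "prob_space M" and M: "sets M = sets borel" and F: "function_space F"
    and Fexp: "\<And>g. g \<in> F \<Longrightarrow> all_exponential_moments M g" and L: "0 \<le> L"
    and U: "openin (weak_topology_on_probs F) U" and KU: "(\<lambda>f. density M f) ` entropy_ball M L \<subseteq> U"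
  obtains \<B> where "finite \<B>" "\<And>H. H \<in> \<B> \<Longrightarrow> finite H \<and> H \<subseteq> F \<times> UNIV"
    "(\<lambda>f. density M f) ` entropy_ball M L \<subseteq> (\<Union>H\<in>\<B>. open_box F H)" "(\<Union>H\<in>\<B>. open_box F H) \<subseteq> U"
proof -
  interpret prob_space M by fact
  let ?K = "(\<lambda>f. density M (\<lambda>x. ennreal (f x))) ` entropy_ball M L"
  let ?S = "{open_box F {(g, a)} | g a. g \<in> F}"
  define X where "X = topology (arbitrary union_of (finite intersection_of (\<lambda>x. x \<in> ?S) relative_to ?K))"
  note dens = entropy_ball_density[OF prob_space_axioms M Fexp _ L]
  have KP: "?K \<subseteq> probs_integrating F" using dens(1) by auto
  have zero: "(\<lambda>x. 0) \<in> F" using F by (simp add: function_space_def)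
  have KS: "?K \<subseteq> \<Union>?S"
  proof -
    have "probs_integrating F \<subseteq> open_box F {(\<lambda>x. 0, -1)}" by (auto simp: open_box_def)
    then show ?thesis using KP zero by blast
  qed
  have comp: "compact_space X"
  proof (rule Alexander_subbase_alt[OF KS _ X_def[symmetric]])
    fix C assume C: "C \<subseteq> ?S" "?K \<subseteq> \<Union>C"
    show "\<exists>C'. finite C' \<and> C' \<subseteq> C \<and> ?K \<subseteq> \<Union>C'"
    proof (rule ccontr)
      assume no: "\<nexists>C'. finite C' \<and> C' \<subseteq> C \<and> ?K \<subseteq> \<Union>C'"
      define G where "G = {(g, a). g \<in> F \<and> open_box F {(g, a)} \<in> C}"
      have "ball_constrained L G \<noteq> {}"
      proof (rule entropy_ball_finite_intersection[OF _ L])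
        fix H assume H: "finite H" "H \<subseteq> G"
        have "finite ((\<lambda>h. open_box F {h}) ` H)" "(\<lambda>h. open_box F {h}) ` H \<subseteq> C"
          using H by (auto simp: G_def)
        then have "\<not> ?K \<subseteq> \<Union>((\<lambda>h. open_box F {h}) ` H)" using no by blast
        then obtain f where f: "f \<in> entropy_ball M L" "\<And>h. h \<in> H \<Longrightarrow> density M f \<notin> open_box F {h}" by blast
        have "f \<in> ball_constrained L H"
          unfolding ball_constrained_def
        proof (safe intro!: f(1))
          fix g a assume ga: "(g, a) \<in> H"
          then have "g \<in> F" using H by (auto simp: G_def)
          then show "(\<integral>x. g x * f x \<partial>M) \<le> a"
            using f(2)[OF ga] dens(1)[OF _ f(1)] dens(2)[OF _ f(1)] by (auto simp: open_box_def)
        qed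
        then show "ball_constrained L H \<noteq> {}" by auto
      qed (use Fexp in \<open>auto simp: G_def\<close>)
      then obtain f where f: "f \<in> ball_constrained L G" by auto
      then have fb: "f \<in> entropy_ball M L" by (simp add: ball_constrained_def)
      then obtain W where W: "W \<in> C" "density M f \<in> W" using C(2) by blast
      then obtain g a where ga: "g \<in> F" "W = open_box F {(g, a)}" using C(1) by blast
      then have "(g, a) \<in> G" using W by (auto simp: G_def)
      then have "(\<integral>x. g x * f x \<partial>M) \<le> a" using f by (auto simp: ball_constrained_def)
      moreover have "a < (\<integral>x. g x * f x \<partial>M)"
        using W(2) dens(2)[OF _ fb ga(1)] by (auto simp: ga(2) open_box_def)
      ultimately show False by simp
    qed
  qed
  have openX: "openin X = arbitrary union_of (finite intersection_of (\<lambda>x. x \<in> ?S) relative_to ?K)"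
    unfolding X_def by (rule topology_inverse'[OF istopology_subbase])
  have topX: "topspace X = ?K"
    unfolding X_def by (rule topspace_subbase)
  have box_open: "openin X (?K \<inter> open_box F H)" if H: "finite H" "H \<subseteq> F \<times> UNIV" for H
  proof -
    have "openin X (?K \<inter> open_box F {h})" if h: "h \<in> H" for h
    proof -
      have "open_box F {h} \<in> ?S" using h H by (cases h) auto
      then have "(finite intersection_of (\<lambda>x. x \<in> ?S)) (open_box F {h})"
        by (rule finite_intersection_of_inc)
      then have "(finite intersection_of (\<lambda>x. x \<in> ?S) relative_to ?K) (?K \<inter> open_box F {h})"
        by (auto simp: relative_to_def)
      then show ?thesis unfolding openX by (rule arbitrary_union_of_inc)
    qed
    moreover have "?K \<inter> open_box F H = ?K \<inter> (\<Inter>h\<in>H. ?K \<inter> open_box F {h})"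
      using KP by (auto simp: open_box_def)
    moreover have "openin X ?K" using openin_topspace[of X] topX by simp
    ultimately show ?thesis
    proof (cases "H = {}")
      case False
      then have "openin X (\<Inter>h\<in>H. ?K \<inter> open_box F {h})"
        using \<open>\<And>h. h \<in> H \<Longrightarrow> openin X (?K \<inter> open_box F {h})\<close> H by (intro openin_INT2) auto
      then show ?thesis using \<open>openin X ?K\<close> \<open>?K \<inter> open_box F H = _\<close> by (metis openin_Int)
    qed auto
  qed
  have "\<forall>\<nu>\<in>?K. \<exists>H. finite H \<and> H \<subseteq> F \<times> UNIV \<and> \<nu> \<in> open_box F H \<and> open_box F H \<subseteq> U"
    using open_box_neighbourhood[OF F U] KU by blast
  from bchoice[OF this] obtain h
    where h: "\<forall>\<nu>\<in>?K. finite (h \<nu>) \<and> h \<nu> \<subseteq> F \<times> UNIV \<and> \<nu> \<in> open_box F (h \<nu>) \<and> open_box F (h \<nu>) \<subseteq> U"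
    by blast
  let ?W = "\<lambda>\<nu>. ?K \<inter> open_box F (h \<nu>)"
  have "\<forall>W\<in>?W ` ?K. openin X W" using h box_open by blast
  moreover have "topspace X \<subseteq> \<Union>(?W ` ?K)" unfolding topX using h by blast
  ultimately obtain \<C> where \<C>: "finite \<C>" "\<C> \<subseteq> ?W ` ?K" "topspace X \<subseteq> \<Union>\<C>"
    using comp unfolding compact_space_alt by meson
  obtain T where T: "T \<subseteq> ?K" "finite T" "\<C> = ?W ` T"
    using finite_subset_image[OF \<C>(1,2)] by blast
  have TK: "?K \<subseteq> (\<Union>\<nu>\<in>T. ?W \<nu>)" using \<C>(3) unfolding topX T(3) .
  show ?thesis
  proof (rule that[of "h ` T"])
    show "(\<lambda>f. density M f) ` entropy_ball M L \<subseteq> (\<Union>H\<in>h ` T. open_box F H)" using TK by blast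
  qed (use T h in blast)+
qed

section \<open>Exponential bounds outside neighbourhoods of entropy balls\<close>

definition closed_box :: "('a::topological_space \<Rightarrow> real) set \<Rightarrow> (('a \<Rightarrow> real) \<times> real) set \<Rightarrow> 'a measure set" where
  "closed_box F H = {\<nu> \<in> probs_integrating F. \<forall>(g, a)\<in>H. (\<integral>x. g x \<partial>\<nu>) \<le> a}"

lemma entropy_ball_mono: "L \<le> L' \<Longrightarrow> entropy_ball M L \<subseteq> entropy_ball M L'"
  by (auto simp: entropy_ball_def intro: order_trans ennreal_leI)

context prob_space
begin

text \<open>The event that the empirical measure lies in \<open>W\<close> need not be measurable; it is only required to
  be contained in a small measurable one.\<close>

definition empirical_rate_set ::
  "(nat \<Rightarrow> 'a \<Rightarrow> 'b::topological_space) \<Rightarrow> real \<Rightarrow> 'b measure set \<Rightarrow> bool" where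
  "empirical_rate_set X L W \<longleftrightarrow> (\<exists>C\<ge>0. \<forall>n\<ge>1. \<exists>E\<in>events.
     {\<omega> \<in> space M. empirical_measure (\<lambda>i. X i \<omega>) n \<in> W} \<subseteq> E \<and> prob E \<le> C * exp (- real n * L))"

lemma empirical_rate_set_mono:
  assumes "empirical_rate_set X L W" "W' \<subseteq> W"
  shows "empirical_rate_set X L W'"
proof -
  from assms(1) obtain C where C: "C \<ge> 0"
    "\<And>n. n \<ge> 1 \<Longrightarrow> \<exists>E\<in>events. {\<omega> \<in> space M. empirical_measure (\<lambda>i. X i \<omega>) n \<in> W} \<subseteq> E \<and> prob E \<le> C * exp (- real n * L)"
    unfolding empirical_rate_set_def by blast
  have "\<exists>E\<in>events. {\<omega> \<in> space M. empirical_measure (\<lambda>i. X i \<omega>) n \<in> W'} \<subseteq> E \<and> prob E \<le> C * exp (- real n * L)"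
    if "n \<ge> 1" for n
    using C(2)[OF that] assms(2) by blast
  then show ?thesis unfolding empirical_rate_set_def using C(1) by blast
qed

lemma empirical_rate_set_empty: "empirical_rate_set X L {}"
  unfolding empirical_rate_set_def by (intro exI[of _ 0]) (auto intro!: bexI[of _ "{}"])

lemma empirical_rate_set_Un:
  assumes "empirical_rate_set X L V" "empirical_rate_set X L W"
  shows "empirical_rate_set X L (V \<union> W)"
proof -
  let ?e = "\<lambda>n \<omega>. empirical_measure (\<lambda>i. X i \<omega>) n"
  from assms(1) obtain C where C: "C \<ge> 0"
    "\<And>n. n \<ge> 1 \<Longrightarrow> \<exists>E\<in>events. {\<omega> \<in> space M. ?e n \<omega> \<in> V} \<subseteq> E \<and> prob E \<le> C * exp (- real n * L)"
    unfolding empirical_rate_set_def by blast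
  from assms(2) obtain D where D: "D \<ge> 0"
    "\<And>n. n \<ge> 1 \<Longrightarrow> \<exists>E\<in>events. {\<omega> \<in> space M. ?e n \<omega> \<in> W} \<subseteq> E \<and> prob E \<le> D * exp (- real n * L)"
    unfolding empirical_rate_set_def by blast
  have "\<exists>E\<in>events. {\<omega> \<in> space M. ?e n \<omega> \<in> V \<union> W} \<subseteq> E \<and> prob E \<le> (C + D) * exp (- real n * L)"
    if n: "n \<ge> 1" for n
  proof -
    obtain E where E: "E \<in> events" "{\<omega> \<in> space M. ?e n \<omega> \<in> V} \<subseteq> E" "prob E \<le> C * exp (- real n * L)"
      using C(2)[OF n] by blast
    obtain E' where E': "E' \<in> events" "{\<omega> \<in> space M. ?e n \<omega> \<in> W} \<subseteq> E'" "prob E' \<le> D * exp (- real n * L)"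
      using D(2)[OF n] by blast
    have "prob (E \<union> E') \<le> prob E + prob E'"
      using E E' by (intro measure_Un_le) auto
    also have "\<dots> \<le> (C + D) * exp (- real n * L)" using E(3) E'(3) by (simp add: distrib_right)
    finally show ?thesis using E E' by (intro bexI[of _ "E \<union> E'"]) auto
  qed
  then show ?thesis unfolding empirical_rate_set_def using C(1) D(1)
    by (intro exI[of _ "C + D"]) (simp add: add_nonneg_nonneg)
qed

lemma empirical_rate_set_UN:
  "finite I \<Longrightarrow> (\<And>i. i \<in> I \<Longrightarrow> empirical_rate_set X L (W i)) \<Longrightarrow> empirical_rate_set X L (\<Union>i\<in>I. W i)"
  by (induction I rule: finite_induct) (auto intro: empirical_rate_set_empty empirical_rate_set_Un)

text \<open>If the probability exceeded \<open>exp (- n L)\<close>, the average of the conditional laws would have entropy at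
  most \<open>L\<close> and, by linearity of the constraints, would lie in the polyhedron.\<close>

lemma closed_box_rate:
  fixes X :: "nat \<Rightarrow> 'a \<Rightarrow> 'b::topological_space"
  assumes F: "F \<subseteq> borel_measurable borel" and Fexp: "\<And>g. g \<in> F \<Longrightarrow> all_exponential_moments \<mu> g"
    and ind: "indep_vars (\<lambda>_. borel) X {1..}"
    and law: "\<And>i. i \<ge> 1 \<Longrightarrow> distr M borel (X i) = \<mu>"
    and L: "0 \<le> L" and H: "finite H" "H \<subseteq> F \<times> UNIV"
    and disj: "(\<lambda>f. density \<mu> f) ` entropy_ball \<mu> L \<inter> closed_box F H = {}"
  shows "empirical_rate_set X L (closed_box F H)"
proof -
  have X: "i \<ge> 1 \<Longrightarrow> random_variable borel (X i)" for i
    using ind by (auto simp: indep_vars_def)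
  interpret \<mu>: prob_space \<mu> using law[of 1] X[of 1] by (auto intro: prob_space_distr)
  have sets_\<mu>: "sets \<mu> = sets borel" using law[of 1] by auto
  have "\<exists>E\<in>events. {\<omega> \<in> space M. empirical_measure (\<lambda>i. X i \<omega>) n \<in> closed_box F H} \<subseteq> E \<and>
      prob E \<le> 1 * exp (- real n * L)" if n: "n \<ge> 1" for n
  proof -
    define E where "E = {\<omega> \<in> space M. \<forall>(g, a)\<in>H. (\<Sum>i=1..n. g (X i \<omega>)) / n \<le> a}"
    have gm: "(\<lambda>\<omega>. (\<Sum>i=1..n. g (X i \<omega>)) / n) \<in> borel_measurable M" if "g \<in> F" for g
    proof -
      have [measurable]: "g \<in> borel_measurable borel" using F that by auto
      have [measurable]: "i \<in> {1..n} \<Longrightarrow> random_variable borel (X i)" for i using X by simp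
      show ?thesis by measurable
    qed
    have E: "E \<in> events"
    proof -
      have "{\<omega> \<in> space M. (\<Sum>i=1..n. fst h (X i \<omega>)) / n \<le> snd h} \<in> events" if "h \<in> H" for h
        using gm[of "fst h"] that H(2) by (intro borel_measurable_le) auto
      then have "{\<omega> \<in> space M. \<forall>h\<in>H. (\<Sum>i=1..n. fst h (X i \<omega>)) / n \<le> snd h} \<in> events"
        by (intro sets.sets_Collect_finite_All H(1))
      then show ?thesis by (simp add: E_def case_prod_beta)
    qed
    have sub: "{\<omega> \<in> space M. empirical_measure (\<lambda>i. X i \<omega>) n \<in> closed_box F H} \<subseteq> E"
    proof safe
      fix \<omega> assume \<omega>: "\<omega> \<in> space M" "empirical_measure (\<lambda>i. X i \<omega>) n \<in> closed_box F H"
      have "(\<Sum>i=1..n. g (X i \<omega>)) / n \<le> a" if ga: "(g, a) \<in> H" for g a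
      proof -
        have "g \<in> borel_measurable borel" using ga H F by auto
        from integral_empirical_measure(2)[OF n this, of "\<lambda>i. X i \<omega>"] show ?thesis
          using \<omega>(2) ga by (auto simp: closed_box_def)
      qed
      then show "\<omega> \<in> E" using \<omega>(1) by (auto simp: E_def)
    qed
    have "prob E \<le> exp (- real n * L)"
    proof (rule ccontr)
      assume gt: "\<not> prob E \<le> exp (- real n * L)"
      then have gt': "exp (- real n * L) < prob E" by simp
      then have pos: "prob E > 0" using exp_gt_zero less_trans by blast
      obtain f where f: "f \<in> entropy_ball \<mu> (- ln (prob E) / n)"
        and fg: "\<And>g a. all_exponential_moments \<mu> g \<Longrightarrow> (\<And>\<omega>. \<omega> \<in> E \<Longrightarrow> (\<Sum>i=1..n. g (X i \<omega>)) / n \<le> a)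
          \<Longrightarrow> (\<integral>x. g x * f x \<partial>\<mu>) \<le> a"
        using conditioned_mean_density[OF E pos n indep_vars_subset[OF ind] law] by auto
      have "- real n * L < ln (prob E)" using gt' pos by (metis ln_exp ln_less_cancel_iff exp_gt_zero)
      then have "- ln (prob E) \<le> L * real n" by (simp add: mult.commute)
      then have "- ln (prob E) / n \<le> L" using n by (subst pos_divide_le_eq) auto
      then have fL: "f \<in> entropy_ball \<mu> L" using f entropy_ball_mono by blast
      note dens = entropy_ball_density[OF \<mu>.prob_space_axioms sets_\<mu> Fexp fL L]
      have "(\<integral>x. g x \<partial>density \<mu> f) \<le> a" if ga: "(g, a) \<in> H" for g a
      proof -
        have gF: "g \<in> F" using ga H by auto
        have "(\<integral>x. g x * f x \<partial>\<mu>) \<le> a" using ga by (intro fg[OF Fexp[OF gF]]) (auto simp: E_def)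
        then show ?thesis using dens(2)[OF _ gF] by simp
      qed
      then have "density \<mu> f \<in> closed_box F H" using dens(1) by (auto simp: closed_box_def)
      then show False using disj fL by auto
    qed
    then show ?thesis using E sub by (intro bexI[of _ E]) auto
  qed
  then show ?thesis unfolding empirical_rate_set_def by (intro exI[of _ 1]) simp
qed

text \<open>A measure outside the open box \<open>B\<close> violates one of its inequalities, that is, satisfies the
  opposite closed one. Removing the boxes one by one thus splits the remaining set into finitely many
  polyhedra, and the induction ends with polyhedra that miss the entropy ball.\<close>

lemma empirical_rate_set_outside_cover:
  fixes X :: "nat \<Rightarrow> 'a \<Rightarrow> 'b::topological_space"
  assumes F: "F \<subseteq> borel_measurable borel" and Fexp: "\<And>g. g \<in> F \<Longrightarrow> all_exponential_moments \<mu> g"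
    and ind: "indep_vars (\<lambda>_. borel) X {1..}"
    and law: "\<And>i. i \<ge> 1 \<Longrightarrow> distr M borel (X i) = \<mu>"
    and L: "0 \<le> L"
    and \<B>: "finite \<B>" "\<And>B. B \<in> \<B> \<Longrightarrow> finite B \<and> B \<subseteq> F \<times> UNIV"
    and H: "finite H" "H \<subseteq> F \<times> UNIV"
    and cover: "(\<lambda>f. density \<mu> f) ` entropy_ball \<mu> L \<inter> closed_box F H \<subseteq> (\<Union>B\<in>\<B>. open_box F B)"
  shows "empirical_rate_set X L (closed_box F H - (\<Union>B\<in>\<B>. open_box F B))"
  using \<B> H cover
proof (induction \<B> arbitrary: H rule: finite_induct)
  case empty
  have "empirical_rate_set X L (closed_box F H)"
    by (rule closed_box_rate[OF F Fexp ind law L empty(2,3)]) (use empty(4) in auto)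
  then show ?case by simp
next
  case (insert B \<B>)
  have *: "empirical_rate_set X L (closed_box F (Set.insert h H) - (\<Union>B\<in>\<B>. open_box F B))" if h: "h \<in> B" for h
  proof (rule insert.IH)
    show "finite (Set.insert h H)" using insert.prems by simp
    show "Set.insert h H \<subseteq> F \<times> UNIV" using insert.prems h by blast
    have disj: "closed_box F (Set.insert h H) \<inter> open_box F B = {}"
      using h by (auto simp: closed_box_def open_box_def)
    have sub: "closed_box F (Set.insert h H) \<subseteq> closed_box F H" by (auto simp: closed_box_def)
    show "(\<lambda>f. density \<mu> f) ` entropy_ball \<mu> L \<inter> closed_box F (Set.insert h H) \<subseteq> (\<Union>B\<in>\<B>. open_box F B)"
    proof
      fix \<nu> assume \<nu>: "\<nu> \<in> (\<lambda>f. density \<mu> f) ` entropy_ball \<mu> L \<inter> closed_box F (Set.insert h H)"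
      then have "\<nu> \<in> (\<Union>B\<in>Set.insert B \<B>. open_box F B)"
        using subsetD[OF insert.prems(4)] subsetD[OF sub] by (meson IntD1 IntD2 IntI)
      moreover have "\<nu> \<notin> open_box F B" using \<nu> disj by (meson IntD2 disjoint_iff)
      ultimately show "\<nu> \<in> (\<Union>B\<in>\<B>. open_box F B)" by simp
    qed
  qed (use insert.prems in auto)
  have "empirical_rate_set X L (\<Union>h\<in>B. closed_box F (Set.insert h H) - (\<Union>B\<in>\<B>. open_box F B))"
    using insert.prems(1)[of B] by (intro empirical_rate_set_UN *) auto
  moreover have "closed_box F H - (\<Union>B\<in>Set.insert B \<B>. open_box F B)
      \<subseteq> (\<Union>h\<in>B. closed_box F (Set.insert h H) - (\<Union>B\<in>\<B>. open_box F B))"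
    by (auto simp: closed_box_def open_box_def not_less)
  ultimately show ?case by (rule empirical_rate_set_mono)
qed

lemma empirical_rate_set_outside_open:
  fixes X :: "nat \<Rightarrow> 'a \<Rightarrow> 'b::topological_space"
  assumes F: "function_space F" "F \<subseteq> borel_measurable borel"
    and Fexp: "\<And>g. g \<in> F \<Longrightarrow> all_exponential_moments \<mu> g"
    and ind: "indep_vars (\<lambda>_. borel) X {1..}"
    and law: "\<And>i. i \<ge> 1 \<Longrightarrow> distr M borel (X i) = \<mu>"
    and L: "0 \<le> L"
    and U: "openin (weak_topology_on_probs F) U"
    and KU: "(\<lambda>f. density \<mu> f) ` entropy_ball \<mu> L \<subseteq> U"
  shows "empirical_rate_set X L (probs_integrating F - U)"
proof -
  have X: "random_variable borel (X 1)" using ind by (auto simp: indep_vars_def)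
  interpret \<mu>: prob_space \<mu> using law[of 1] X by (auto intro: prob_space_distr)
  have sets_\<mu>: "sets \<mu> = sets borel" using law[of 1] by auto
  obtain \<B> where \<B>: "finite \<B>" "\<And>H. H \<in> \<B> \<Longrightarrow> finite H \<and> H \<subseteq> F \<times> UNIV"
    "(\<lambda>f. density \<mu> f) ` entropy_ball \<mu> L \<subseteq> (\<Union>H\<in>\<B>. open_box F H)" "(\<Union>H\<in>\<B>. open_box F H) \<subseteq> U"
    using entropy_ball_finite_cover[OF \<mu>.prob_space_axioms sets_\<mu> F(1) Fexp L U KU] by blast
  have "empirical_rate_set X L (closed_box F {} - (\<Union>B\<in>\<B>. open_box F B))"
    by (rule empirical_rate_set_outside_cover[OF F(2) Fexp ind law L \<B>(1,2)]) (use \<B>(3) in auto)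
  then show ?thesis
    by (rule empirical_rate_set_mono) (use \<B>(4) in \<open>auto simp: closed_box_def\<close>)
qed

end

section \<open>Transportation functions are deviation functions\<close>

lemma limsup_log_prob_le:
  fixes p :: "nat \<Rightarrow> real"
  assumes p: "\<And>n. n \<ge> 1 \<Longrightarrow> p n \<le> C * exp (- real n * L)" and nn: "\<And>n. 0 \<le> p n" and C: "0 \<le> C"
  shows "limsup (\<lambda>n. ereal (1 / real n) * log_prob (p n)) \<le> ereal (- L)"
proof -
  let ?C = "C + 1"
  have le: "ereal (1 / real n) * log_prob (p n) \<le> ereal (ln ?C / real n - L)" if n: "n \<ge> 1" for n
  proof (cases "p n = 0")
    case True
    then show ?thesis using n by (simp add: log_prob_def)
  next
    case False
    then have pos: "0 < p n" using nn[of n] by simp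
    have "p n \<le> ?C * exp (- real n * L)" using p[OF n] exp_ge_zero[of "- real n * L"] unfolding distrib_right by linarith
    then have "ln (p n) \<le> ln (?C * exp (- real n * L))" using pos C by (subst ln_le_cancel_iff) auto
    also have "\<dots> = ln ?C - real n * L" using C by (subst ln_mult) auto
    finally have "ln (p n) / n \<le> (ln ?C - real n * L) / n" by (intro divide_right_mono) auto
    also have "\<dots> = ln ?C / real n - L" using n by (simp add: diff_divide_distrib)
    finally show ?thesis using False by (simp add: log_prob_def)
  qed
  have "(\<lambda>n. ln ?C / real n - L) \<longlonglongrightarrow> 0 - L"
    by (intro tendsto_intros lim_const_over_n)
  then have "(\<lambda>n. ereal (ln ?C / real n - L)) \<longlonglongrightarrow> ereal (- L)" by simp
  then have "limsup (\<lambda>n. ereal (ln ?C / real n - L)) = ereal (- L)"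
    by (rule lim_imp_Limsup[OF trivial_limit_sequentially])
  moreover have "limsup (\<lambda>n. ereal (1 / real n) * log_prob (p n)) \<le> limsup (\<lambda>n. ereal (ln ?C / real n - L))"
    using le by (intro Limsup_mono) (auto simp: eventually_sequentially)
  ultimately show ?thesis by simp
qed

lemma rate_profile_tendsto:
  assumes "rate_profile \<alpha>"
  shows "(\<alpha> \<longlongrightarrow> (SUP t\<in>{0..}. \<alpha> t)) at_top"
proof (rule increasing_tendsto)
  show "\<forall>\<^sub>F t in at_top. \<alpha> t \<le> (SUP t\<in>{0..}. \<alpha> t)"
    using eventually_ge_at_top[of 0] by eventually_elim (auto intro: SUP_upper)
  fix x assume "x < (SUP t\<in>{0..}. \<alpha> t)"
  then obtain s where s: "0 \<le> s" "x < \<alpha> s" by (auto simp: less_SUP_iff)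
  show "\<forall>\<^sub>F t in at_top. x < \<alpha> t"
    using eventually_ge_at_top[of s]
  proof eventually_elim
    case (elim t)
    then have "\<alpha> s \<le> \<alpha> t" using assms s by (auto simp: rate_profile_def mono_on_def)
    then show ?case using s by order
  qed
qed

lemma extend_to_infinity_infinity:
  assumes "rate_profile \<alpha>"
  shows "extend_to_infinity \<alpha> \<infinity> = (SUP t\<in>{0..}. \<alpha> t)"
  unfolding extend_to_infinity_def using tendsto_Lim[OF _ rate_profile_tendsto[OF assms]] by simp

lemma extend_to_infinity_ge:
  assumes \<alpha>: "rate_profile \<alpha>" and t: "0 \<le> t" "ereal t \<le> T"
  shows "\<alpha> t \<le> extend_to_infinity \<alpha> T"
proof (cases T)
  case (real r)
  then show ?thesis using \<alpha> t by (auto simp: extend_to_infinity_def rate_profile_def mono_on_def)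
next
  case PInf
  then show ?thesis using t by (auto simp: extend_to_infinity_infinity[OF \<alpha>] intro: SUP_upper)
qed (use t in auto)

text \<open>For every \<open>L < \<alpha> t\<close> the transportation inequality places the entropy ball of radius \<open>L\<close> inside
  the open set \<open>{T < t}\<close>. The empirical measure then leaves this set with probability at most a
  constant times \<open>exp (- n L)\<close>.\<close>

lemma transportation_imp_deviation:
  fixes \<mu> :: "'a::topological_space measure" and X :: "nat \<Rightarrow> 'w \<Rightarrow> 'a"
  assumes mu: "\<mu> \<in> borel_probs" and F: "function_space F" "F \<subseteq> borel_measurable borel"
    and Fexp: "\<And>g. g \<in> F \<Longrightarrow> all_exponential_moments \<mu> g"
    and M: "prob_space M"
    and ind: "prob_space.indep_vars M (\<lambda>_. borel) X {1..}"
    and law: "\<And>i. i \<ge> 1 \<Longrightarrow> distr M borel (X i) = \<mu>"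
    and cont: "continuous_map (weak_topology_on_probs F) euclidean (transport_cost \<mu> \<Phi>)"
    and \<alpha>: "transportation_function \<mu> F \<Phi> \<alpha>"
  shows "deviation_function \<mu> \<Phi> M X \<alpha>"
proof -
  interpret prob_space M by fact
  interpret \<mu>: prob_space \<mu> using mu by (simp add: borel_probs_def)
  have sets_\<mu>: "sets \<mu> = sets borel" using mu by (simp add: borel_probs_def)
  let ?T = "transport_cost \<mu> \<Phi>"
  have prof: "rate_profile \<alpha>"
    and trans: "\<And>\<nu>. \<nu> \<in> probs_integrating F \<Longrightarrow> extend_to_infinity \<alpha> (?T \<nu>) \<le> relative_entropy \<nu> \<mu>"
    using \<alpha> by (auto simp: transportation_function_def)
  have top: "topspace (weak_topology_on_probs F) = probs_integrating F"
    using F(1) by (intro topspace_weak_topology_on_probs) (auto simp: function_space_def)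
  have "limsup (\<lambda>n. ereal (1 / real n) * log_prob (measure M {\<omega> \<in> space M.
      ?T (empirical_measure (\<lambda>i. X i \<omega>) n) \<ge> ereal t})) \<le> - \<alpha> t" (is "?lim \<le> _") if t: "0 \<le> t" for t
  proof (rule dense_ge)
    fix y assume "- \<alpha> t < y"
    then have y: "- y < \<alpha> t" by (simp add: ereal_uminus_less_reorder)
    have base: "?lim \<le> ereal (- L)" if L: "0 \<le> L" "ereal L < \<alpha> t \<or> L = 0" for L
    proof -
      have "\<exists>C\<ge>0. \<forall>n\<ge>1. measure M {\<omega> \<in> space M. ?T (empirical_measure (\<lambda>i. X i \<omega>) n) \<ge> ereal t}
          \<le> C * exp (- real n * L)"
      proof (cases "L = 0")
        case True
        then show ?thesis by (intro exI[of _ 1]) simp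
      next
        case False
        define U where "U = {\<nu> \<in> probs_integrating F. ?T \<nu> \<in> {..<ereal t}}"
        have U: "openin (weak_topology_on_probs F) U"
          using cont unfolding U_def top[symmetric] by (rule openin_continuous_map_preimage) simp
        have KU: "(\<lambda>f. density \<mu> f) ` entropy_ball \<mu> L \<subseteq> U"
        proof safe
          fix f assume f: "f \<in> entropy_ball \<mu> L"
          note dens = entropy_ball_density[OF \<mu>.prob_space_axioms sets_\<mu> Fexp f L(1)]
          have "extend_to_infinity \<alpha> (?T (density \<mu> f)) \<le> ereal L"
            using trans[OF dens(1)] dens(3) order_trans by blast
          then have "extend_to_infinity \<alpha> (?T (density \<mu> f)) < \<alpha> t" using L(2) False by auto
          then have "\<not> ereal t \<le> ?T (density \<mu> f)" using extend_to_infinity_ge[OF prof t] leD by blast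
          then show "density \<mu> f \<in> U" using dens(1) by (simp add: U_def not_le)
        qed
        have "empirical_rate_set X L (probs_integrating F - U)"
          by (rule empirical_rate_set_outside_open[OF F Fexp ind law L(1) U KU])
        then obtain C where C: "C \<ge> 0" "\<And>n. n \<ge> 1 \<Longrightarrow> \<exists>E\<in>events.
           {\<omega> \<in> space M. empirical_measure (\<lambda>i. X i \<omega>) n \<in> probs_integrating F - U} \<subseteq> E \<and> prob E \<le> C * exp (- real n * L)"
          unfolding empirical_rate_set_def by blast
        have "prob {\<omega> \<in> space M. ?T (empirical_measure (\<lambda>i. X i \<omega>) n) \<ge> ereal t} \<le> C * exp (- real n * L)"
          if n: "n \<ge> 1" for n
        proof -
          obtain E where E: "E \<in> events" "prob E \<le> C * exp (- real n * L)"
            "{\<omega> \<in> space M. empirical_measure (\<lambda>i. X i \<omega>) n \<in> probs_integrating F - U} \<subseteq> E"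
            using C(2)[OF n] by blast
          have "{\<omega> \<in> space M. ?T (empirical_measure (\<lambda>i. X i \<omega>) n) \<ge> ereal t} \<subseteq> E"
            using E(3) empirical_measure_probs_integrating[OF n F(2)] by (fastforce simp: U_def)
          then have "prob {\<omega> \<in> space M. ?T (empirical_measure (\<lambda>i. X i \<omega>) n) \<ge> ereal t} \<le> prob E"
            by (intro finite_measure_mono E(1))
          then show ?thesis using E(2) by simp
        qed
        then show ?thesis using C(1) by blast
      qed
      then obtain C where "C \<ge> 0" "\<And>n. n \<ge> 1 \<Longrightarrow> measure M {\<omega> \<in> space M. ?T (empirical_measure (\<lambda>i. X i \<omega>) n) \<ge> ereal t}
          \<le> C * exp (- real n * L)" by blast
      then show ?thesis by (intro limsup_log_prob_le) auto
    qed
    show "?lim \<le> y"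
    proof (cases y)
      case (real r)
      show ?thesis
      proof (cases "0 \<le> r")
        case True
        have "?lim \<le> ereal (- 0)" by (rule base) auto
        then show ?thesis using True real by (auto intro: order_trans)
      next
        case False
        then show ?thesis using base[of "- r"] y real by auto
      qed
    qed (use y in auto)
  qed
  then show ?thesis using prof by (simp add: deviation_function_def)
qed

section \<open>The weak law of large numbers\<close>

context prob_space
begin

lemma product_coordinates_indep:
  assumes I: "finite I" "I \<noteq> {}"
  shows "prob_space.indep_vars (PiM I (\<lambda>_. M)) (\<lambda>_. M) (\<lambda>i x. x i) I"
proof -
  interpret P: prob_space "PiM I (\<lambda>_. M)" by (intro prob_space_PiM prob_space_axioms)
  have "distr (PiM I (\<lambda>_. M)) (PiM I (\<lambda>_. M)) (\<lambda>x. \<lambda>i\<in>I. x i) = distr (PiM I (\<lambda>_. M)) (PiM I (\<lambda>_. M)) (\<lambda>x. x)"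
    by (intro distr_cong) (auto simp: space_PiM restrict_PiE)
  also have "\<dots> = PiM I (\<lambda>_. M)" by simp
  also have "\<dots> = PiM I (\<lambda>i. distr (PiM I (\<lambda>_. M)) M (\<lambda>x. x i))"
    by (intro PiM_cong refl distr_PiM_component[of I "\<lambda>_. M", symmetric]) (simp_all add: prob_space_axioms)
  finally show ?thesis
    by (subst P.indep_vars_iff_distr_eq_PiM'[OF I(2)]) auto
qed

lemma product_coordinate_integral:
  fixes g :: "'a \<Rightarrow> real"
  assumes "i \<in> I" and [measurable]: "g \<in> borel_measurable M"
  shows "(\<integral>x. g (x i) \<partial>PiM I (\<lambda>_. M)) = integral\<^sup>L M g"
    "integrable (PiM I (\<lambda>_. M)) (\<lambda>x. g (x i)) \<longleftrightarrow> integrable M g"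
proof -
  have d: "distr (PiM I (\<lambda>_. M)) M (\<lambda>x. x i) = M"
    using assms by (intro distr_PiM_component prob_space_axioms)
  have m: "(\<lambda>x. x i) \<in> measurable (PiM I (\<lambda>_. M)) M" using assms by simp
  show "(\<integral>x. g (x i) \<partial>PiM I (\<lambda>_. M)) = integral\<^sup>L M g"
    using integral_distr[OF m, of g] d by simp
  show "integrable (PiM I (\<lambda>_. M)) (\<lambda>x. g (x i)) \<longleftrightarrow> integrable M g"
    using integrable_distr_eq[OF m, of g] d by simp
qed

lemma L1_bounded_approximation:
  fixes g :: "'a \<Rightarrow> real"
  assumes g: "integrable M g" and d: "\<delta> > 0"
  obtains h K where "h \<in> borel_measurable M" "\<And>x. \<bar>h x\<bar> \<le> K" "K > 0" "(\<integral>x. \<bar>g x - h x\<bar> \<partial>M) < \<delta>"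
proof -
  have [measurable]: "g \<in> borel_measurable M" using g by auto
  define h where "h k x = (if \<bar>g x\<bar> \<le> real k then g x else 0)" for k x
  have [measurable]: "h k \<in> borel_measurable M" for k unfolding h_def by measurable
  have "(\<lambda>k. \<integral>x. \<bar>g x - h k x\<bar> \<partial>M) \<longlonglongrightarrow> (\<integral>x. 0 \<partial>M)"
  proof (rule integral_dominated_convergence[where w="\<lambda>x. \<bar>g x\<bar>"])
    show "AE x in M. (\<lambda>k. \<bar>g x - h k x\<bar>) \<longlonglongrightarrow> 0"
    proof (intro AE_I2)
      fix x
      have "\<forall>\<^sub>F k in sequentially. \<bar>g x - h k x\<bar> = 0"
        using eventually_ge_at_top[of "nat \<lceil>\<bar>g x\<bar>\<rceil>"]
        by eventually_elim (simp add: h_def nat_le_iff ceiling_le_iff)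
      then show "(\<lambda>k. \<bar>g x - h k x\<bar>) \<longlonglongrightarrow> 0" by (rule tendsto_eventually)
    qed
  qed (use g in \<open>auto simp: h_def\<close>)
  then have "\<forall>\<^sub>F k in sequentially. (\<integral>x. \<bar>g x - h k x\<bar> \<partial>M) < \<delta>"
    using d by (intro order_tendstoD(2)) auto
  then obtain k where k: "(\<integral>x. \<bar>g x - h k x\<bar> \<partial>M) < \<delta>"
    by (auto simp: eventually_sequentially)
  show ?thesis
    by (rule that[of "h k" "real k + 1"]) (use k in \<open>auto simp: h_def\<close>)
qed

text \<open>Only integrability is available, so \<open>g\<close> is split into a bounded function \<open>h\<close> and a remainder of small
  mean. Hoeffding's inequality controls the sample mean of \<open>h\<close>, Markov's inequality that of
  \<open>|g - h|\<close>.\<close>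

lemma weak_law_of_large_numbers:
  fixes g :: "'a \<Rightarrow> real"
  assumes g: "integrable M g" and e: "\<epsilon> > 0" and eta: "\<eta> > 0"
  shows "\<forall>\<^sub>F n in sequentially.
    measure (PiM {1..n} (\<lambda>_. M)) {x \<in> space (PiM {1..n} (\<lambda>_. M)). \<epsilon> \<le> \<bar>(\<Sum>i=1..n. g (x i)) / n - integral\<^sup>L M g\<bar>} \<le> \<eta>"
proof -
  have [measurable]: "g \<in> borel_measurable M" using g by auto
  \<comment> \<open>The error \<open>\<epsilon>\<close> is shared by the fluctuation of \<open>h\<close>, the remainder and the change of mean; the
    second term makes the Markov bound \<open>3 \<delta> / \<epsilon>\<close> at most \<open>\<eta> / 2\<close>.\<close>
  define \<delta> where "\<delta> = min (\<epsilon> / 3) (\<eta> * \<epsilon> / 6)"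
  have \<delta>: "\<delta> > 0" "\<delta> \<le> \<epsilon> / 3" "\<delta> \<le> \<eta> * \<epsilon> / 6" using e eta by (auto simp: \<delta>_def)
  obtain h K where h [measurable]: "h \<in> borel_measurable M" and hK: "\<And>x. \<bar>h x\<bar> \<le> K" "K > 0"
    and r: "(\<integral>x. \<bar>g x - h x\<bar> \<partial>M) < \<delta>" using L1_bounded_approximation[OF g \<delta>(1)] by metis
  have hi: "integrable M h" by (rule integrable_const_bound[where B=K]) (use hK in auto)
  have rint: "integrable M (\<lambda>x. \<bar>g x - h x\<bar>)" using g hi by auto
  have m_diff: "\<bar>integral\<^sup>L M g - integral\<^sup>L M h\<bar> < \<epsilon> / 3"
  proof -
    have "\<bar>integral\<^sup>L M g - integral\<^sup>L M h\<bar> = \<bar>\<integral>x. g x - h x \<partial>M\<bar>" using g hi by simp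
    also have "\<dots> \<le> (\<integral>x. \<bar>g x - h x\<bar> \<partial>M)" by (rule integral_abs_bound)
    finally show ?thesis using r \<delta> by linarith
  qed
  have bound: "measure (PiM {1..n} (\<lambda>_. M)) {x \<in> space (PiM {1..n} (\<lambda>_. M)). \<epsilon> \<le> \<bar>(\<Sum>i=1..n. g (x i)) / n - integral\<^sup>L M g\<bar>}
      \<le> 2 * exp (- (\<epsilon>\<^sup>2 / (18 * K\<^sup>2)) * real n) + \<eta> / 2" if n: "n \<ge> 1" for n
  proof -
    let ?P = "PiM {1..n} (\<lambda>_. M)"
    interpret P: prob_space ?P by (intro prob_space_PiM prob_space_axioms)
    interpret H: Hoeffding_ineq ?P "{1..n}" "\<lambda>i x. h (x i)" "\<lambda>_. - K" "\<lambda>_. K"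
      "\<Sum>i\<in>{1..n}. P.expectation (\<lambda>x. h (x i))"
    proof unfold_locales
      show "P.indep_vars (\<lambda>_. borel) (\<lambda>i x. h (x i)) {1..n}"
        using n by (intro P.indep_vars_compose2[OF product_coordinates_indep]) auto
      show "AE x in ?P. h (x i) \<in> {- K..K}" for i using hK(1)[of "_ i"] by (intro AE_I2) (auto simp: abs_le_iff minus_le_iff)
    qed auto
    have mean: "(\<Sum>i\<in>{1..n}. P.expectation (\<lambda>x. h (x i))) = n * integral\<^sup>L M h"
      using product_coordinate_integral(1)[OF _ h, of _ "{1..n}"] by simp
    have gi: "i \<in> {1..n} \<Longrightarrow> (\<lambda>x. g (x i)) \<in> borel_measurable ?P" for i by simp
    have hi': "i \<in> {1..n} \<Longrightarrow> (\<lambda>x. h (x i)) \<in> borel_measurable ?P" for i by simp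
    note [measurable] = gi hi'
    let ?B1 = "{x \<in> space ?P. n * \<epsilon> / 3 \<le> \<bar>(\<Sum>i=1..n. h (x i)) - n * integral\<^sup>L M h\<bar>}"
    let ?B2 = "{x \<in> space ?P. n * \<epsilon> / 3 \<le> (\<Sum>i=1..n. \<bar>g (x i) - h (x i)\<bar>)}"
    have B1: "P.prob ?B1 \<le> 2 * exp (- (\<epsilon>\<^sup>2 / (18 * K\<^sup>2)) * real n)"
    proof -
      have s: "(\<Sum>i\<in>{1..n}. (K - - K)\<^sup>2) = n * (4 * K\<^sup>2)" by (simp add: power2_eq_square)
      have "P.prob ?B1 \<le> 2 * exp (-2 * (n * \<epsilon> / 3)\<^sup>2 / (n * (4 * K\<^sup>2)))"
        using H.Hoeffding_ineq_abs_ge[of "n * \<epsilon> / 3"] e hK(2) n unfolding s mean by simp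
      also have "-2 * (n * \<epsilon> / 3)\<^sup>2 / (n * (4 * K\<^sup>2)) = - (\<epsilon>\<^sup>2 / (18 * K\<^sup>2)) * real n"
        using n hK(2) by (simp add: field_simps power2_eq_square)
      finally show ?thesis .
    qed
    have B2: "P.prob ?B2 \<le> \<eta> / 2"
    proof -
      have i': "integrable ?P (\<lambda>x. \<bar>g (x i) - h (x i)\<bar>)" "(\<integral>x. \<bar>g (x i) - h (x i)\<bar> \<partial>?P) = (\<integral>x. \<bar>g x - h x\<bar> \<partial>M)"
        if "i \<in> {1..n}" for i
        using product_coordinate_integral[OF that, of "\<lambda>x. \<bar>g x - h x\<bar>"] rint by auto
      have "P.prob ?B2 \<le> (\<integral>x. (\<Sum>i=1..n. \<bar>g (x i) - h (x i)\<bar>) \<partial>?P) / (n * \<epsilon> / 3)"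
        using i' n e
        by (intro integral_Markov_inequality_measure[where A="{}"]) (auto intro!: sum_nonneg)
      also have "(\<integral>x. (\<Sum>i=1..n. \<bar>g (x i) - h (x i)\<bar>) \<partial>?P) = n * (\<integral>x. \<bar>g x - h x\<bar> \<partial>M)"
        using i' by (subst Bochner_Integration.integral_sum) auto
      also have "\<dots> / (n * \<epsilon> / 3) = 3 * (\<integral>x. \<bar>g x - h x\<bar> \<partial>M) / \<epsilon>" using n by simp
      also have "\<dots> \<le> 3 * (\<eta> * \<epsilon> / 6) / \<epsilon>" 
      proof (intro divide_right_mono mult_left_mono)
        show "(\<integral>x. \<bar>g x - h x\<bar> \<partial>M) \<le> \<eta> * \<epsilon> / 6" using r \<delta> by linarith
      qed (use e in auto)
      also have "\<dots> = \<eta> / 2" using e by simp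
      finally show ?thesis .
    qed
    have "{x \<in> space ?P. \<epsilon> \<le> \<bar>(\<Sum>i=1..n. g (x i)) / n - integral\<^sup>L M g\<bar>} \<subseteq> ?B1 \<union> ?B2"
    proof (rule subsetI, rule ccontr)
      fix x assume x: "x \<in> {x \<in> space ?P. \<epsilon> \<le> \<bar>(\<Sum>i=1..n. g (x i)) / n - integral\<^sup>L M g\<bar>}" "x \<notin> ?B1 \<union> ?B2"
      let ?s = "\<Sum>i=1..n. h (x i)"
      have 1: "\<bar>?s - n * integral\<^sup>L M h\<bar> < n * \<epsilon> / 3" using x by auto
      have 2: "\<bar>(\<Sum>i=1..n. g (x i)) - ?s\<bar> < n * \<epsilon> / 3"
      proof -
        have "\<bar>(\<Sum>i=1..n. g (x i)) - ?s\<bar> = \<bar>\<Sum>i=1..n. g (x i) - h (x i)\<bar>" by (simp add: sum_subtractf)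
        also have "\<dots> \<le> (\<Sum>i=1..n. \<bar>g (x i) - h (x i)\<bar>)" by (rule sum_abs)
        finally show ?thesis using x by auto
      qed
      have 3: "\<bar>n * integral\<^sup>L M h - n * integral\<^sup>L M g\<bar> \<le> n * \<epsilon> / 3"
      proof -
        have "\<bar>n * integral\<^sup>L M h - n * integral\<^sup>L M g\<bar> = n * \<bar>integral\<^sup>L M g - integral\<^sup>L M h\<bar>"
          by (simp add: abs_mult abs_minus_commute flip: right_diff_distrib)
        also have "\<dots> \<le> n * (\<epsilon> / 3)" using m_diff by (intro mult_left_mono) auto
        finally show ?thesis by simp
      qed
      have "\<bar>(\<Sum>i=1..n. g (x i)) - n * integral\<^sup>L M g\<bar> < n * \<epsilon>" using 1 2 3 by argo
      moreover have "\<bar>(\<Sum>i=1..n. g (x i)) / n - integral\<^sup>L M g\<bar> = \<bar>(\<Sum>i=1..n. g (x i)) - n * integral\<^sup>L M g\<bar> / n"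
      proof -
        have "\<bar>s / n - m\<bar> = \<bar>s - n * m\<bar> / n" for s m :: real
        proof -
          have "s / n - m = (s - n * m) / n" using n by (simp add: diff_divide_distrib)
          then show ?thesis by (simp add: abs_divide)
        qed
        then show ?thesis .
      qed
      ultimately have "\<bar>(\<Sum>i=1..n. g (x i)) / n - integral\<^sup>L M g\<bar> < \<epsilon>" using n by (simp add: divide_less_eq mult.commute)
      then show False using x by simp
    qed
    then have "P.prob {x \<in> space ?P. \<epsilon> \<le> \<bar>(\<Sum>i=1..n. g (x i)) / n - integral\<^sup>L M g\<bar>} \<le> P.prob (?B1 \<union> ?B2)"
      by (intro P.finite_measure_mono) measurable
    also have "\<dots> \<le> P.prob ?B1 + P.prob ?B2" by (intro measure_Un_le) measurable
    finally show ?thesis using B1 B2 by linarith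
  qed
  have "(\<lambda>n. 2 * exp (- (\<epsilon>\<^sup>2 / (18 * K\<^sup>2)) * real n)) \<longlonglongrightarrow> 2 * 0"
  proof (intro tendsto_intros)
    define c where "c = \<epsilon>\<^sup>2 / (18 * K\<^sup>2)"
    have "c > 0" using e hK(2) by (simp add: c_def)
    then have "(\<lambda>n. exp (- c) ^ n) \<longlonglongrightarrow> 0" by (intro LIMSEQ_realpow_zero) auto
    then have "(\<lambda>n. exp (- c * real n)) \<longlonglongrightarrow> 0" by (simp add: exp_of_nat_mult[symmetric] mult.commute)
    then show "(\<lambda>n. exp (- (\<epsilon>\<^sup>2 / (18 * K\<^sup>2)) * real n)) \<longlonglongrightarrow> 0" by (simp add: c_def)
  qed
  then have "\<forall>\<^sub>F n in sequentially. 2 * exp (- (\<epsilon>\<^sup>2 / (18 * K\<^sup>2)) * real n) < \<eta> / 2"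
    by (rule order_tendstoD(2)) (use eta in simp)
  then show ?thesis using eventually_ge_at_top[of 1]
  proof eventually_elim
    case (elim n)
    then show ?case using bound[of n] by linarith
  qed
qed

end

section \<open>The lower bound by change of measure\<close>

lemma (in prob_space) PiM_density:
  assumes I: "finite I" and [measurable]: "f \<in> borel_measurable M" and ps: "prob_space (density M f)"
  shows "PiM I (\<lambda>_. density M f) = density (PiM I (\<lambda>_. M)) (\<lambda>x. \<Prod>i\<in>I. f (x i))"
proof -
  interpret N: prob_space "density M f" by fact
  interpret PM: product_sigma_finite "\<lambda>_. M" by unfold_locales
  interpret PN: product_sigma_finite "\<lambda>_. density M f" by unfold_locales
  have "density (PiM I (\<lambda>_. M)) (\<lambda>x. \<Prod>i\<in>I. f (x i)) = PiM I (\<lambda>_. density M f)"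
  proof (rule PN.PiM_eqI[OF I])
    show "sets (density (PiM I (\<lambda>_. M)) (\<lambda>x. \<Prod>i\<in>I. f (x i))) = sets (PiM I (\<lambda>_. density M f))"
      by (simp cong: sets_PiM_cong)
    fix A assume A: "\<And>i. i \<in> I \<Longrightarrow> A i \<in> sets (density M f)"
    then have A' [measurable]: "i \<in> I \<Longrightarrow> A i \<in> sets M" for i by simp
    have [measurable]: "(\<lambda>x. \<Prod>i\<in>I. f (x i)) \<in> borel_measurable (PiM I (\<lambda>_. M))"
      by measurable
    have "emeasure (density (PiM I (\<lambda>_. M)) (\<lambda>x. \<Prod>i\<in>I. f (x i))) (Pi\<^sub>E I A)
       = (\<integral>\<^sup>+x. (\<Prod>i\<in>I. f (x i)) * indicator (Pi\<^sub>E I A) x \<partial>PiM I (\<lambda>_. M))"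
      using A' I by (intro emeasure_density) (auto intro!: sets_PiM_I_finite)
    also have "\<dots> = (\<integral>\<^sup>+x. (\<Prod>i\<in>I. f (x i) * indicator (A i) (x i)) \<partial>PiM I (\<lambda>_. M))"
    proof (rule nn_integral_cong)
      fix x assume "x \<in> space (PiM I (\<lambda>_. M))"
      then have ext: "x \<in> extensional I" by (auto simp: space_PiM PiE_def)
      have "(indicator (Pi\<^sub>E I A) x :: ennreal) = (\<Prod>i\<in>I. indicator (A i) (x i))"
      proof (cases "\<forall>i\<in>I. x i \<in> A i")
        case True
        then show ?thesis using ext by (auto simp: PiE_def Pi_def)
      next
        case False
        then have "x \<notin> Pi\<^sub>E I A" by auto
        moreover have "(\<Prod>i\<in>I. indicator (A i) (x i) :: ennreal) = 0"
          using False I by (intro prod_zero) (auto simp: indicator_def)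
        ultimately show ?thesis by simp
      qed
      then show "(\<Prod>i\<in>I. f (x i)) * indicator (Pi\<^sub>E I A) x = (\<Prod>i\<in>I. f (x i) * indicator (A i) (x i))"
        by (simp add: prod.distrib)
    qed
    also have "\<dots> = (\<Prod>i\<in>I. \<integral>\<^sup>+x. f x * indicator (A i) x \<partial>M)"
      using I by (intro PM.product_nn_integral_prod) auto
    also have "\<dots> = (\<Prod>i\<in>I. emeasure (density M f) (A i))"
      by (intro prod.cong refl emeasure_density[symmetric]) auto
    finally show "emeasure (density (PiM I (\<lambda>_. M)) (\<lambda>x. \<Prod>i\<in>I. f (x i))) (Pi\<^sub>E I A)
       = (\<Prod>i\<in>I. emeasure (density M f) (A i))" .
  qed
  then show ?thesis by simp
qed

text \<open>Let \<open>G\<close> be the event that the mean of \<open>\<phi>\<close> exceeds \<open>c\<close> and the mean of \<open>ln f\<close> is at most \<open>K\<close>. By the law of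
  large numbers the product of the tilted measures gives it probability at least 1/2. On \<open>G\<close> the
  density \<open>\<Prod>f(x\<^sub>i)\<close> of that product is at most \<open>exp (n K)\<close>, so the original product gives \<open>G\<close> at least
  the fraction \<open>exp (- n K)\<close> of this.\<close>

lemma (in prob_space) change_of_measure_lower_bound:
  fixes f \<phi> :: "'a \<Rightarrow> real"
  assumes f [measurable]: "f \<in> borel_measurable M" and nn: "\<And>x. 0 \<le> f x"
    and ps: "prob_space (density M f)"
    and lnf: "integrable (density M f) (\<lambda>x. ln (f x))"
    and \<phi>: "integrable (density M f) \<phi>" and c: "c < (\<integral>x. \<phi> x \<partial>density M f)"
    and K: "(\<integral>x. ln (f x) \<partial>density M f) < K"
  shows "\<forall>\<^sub>F n in sequentially. 1 / 2 * exp (- real n * K)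
      \<le> measure (PiM {1..n} (\<lambda>_. M)) {x \<in> space (PiM {1..n} (\<lambda>_. M)). c < (\<Sum>i=1..n. \<phi> (x i)) / n}"
proof -
  let ?N = "density M f"
  interpret N: prob_space ?N by fact
  have [measurable]: "\<phi> \<in> borel_measurable M" using \<phi> by auto
  let ?PM = "\<lambda>n. PiM {1..n} (\<lambda>_. M)" and ?PN = "\<lambda>n. PiM {1..n} (\<lambda>_. ?N)"
  have "\<forall>\<^sub>F n in sequentially. measure (?PN n) {x \<in> space (?PN n).
      (\<integral>x. \<phi> x \<partial>?N) - c \<le> \<bar>(\<Sum>i=1..n. \<phi> (x i)) / n - (\<integral>x. \<phi> x \<partial>?N)\<bar>} \<le> 1 / 4"
    by (rule N.weak_law_of_large_numbers[OF \<phi>]) (use c in auto)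
  moreover have "\<forall>\<^sub>F n in sequentially. measure (?PN n) {x \<in> space (?PN n).
      K - (\<integral>x. ln (f x) \<partial>?N) \<le> \<bar>(\<Sum>i=1..n. ln (f (x i))) / n - (\<integral>x. ln (f x) \<partial>?N)\<bar>} \<le> 1 / 4"
    by (rule N.weak_law_of_large_numbers[OF lnf]) (use K in auto)
  ultimately show ?thesis using eventually_ge_at_top[of 1]
  proof eventually_elim
    case (elim n)
    interpret P: prob_space "?PN n" by (intro prob_space_PiM N.prob_space_axioms)
    interpret Q: prob_space "?PM n" by (intro prob_space_PiM prob_space_axioms)
    have sp: "space (?PN n) = space (?PM n)" by (simp add: space_PiM)
    have st: "sets (?PN n) = sets (?PM n)" by (simp cong: sets_PiM_cong)
    let ?B = "{x \<in> space (?PM n). c < (\<Sum>i=1..n. \<phi> (x i)) / n}"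
    let ?G = "{x \<in> space (?PM n). c < (\<Sum>i=1..n. \<phi> (x i)) / n \<and> (\<Sum>i=1..n. ln (f (x i))) \<le> n * K}"
    let ?B1 = "{x \<in> space (?PN n). (\<integral>x. \<phi> x \<partial>?N) - c \<le> \<bar>(\<Sum>i=1..n. \<phi> (x i)) / n - (\<integral>x. \<phi> x \<partial>?N)\<bar>}"
    let ?B2 = "{x \<in> space (?PN n). K - (\<integral>x. ln (f x) \<partial>?N) \<le> \<bar>(\<Sum>i=1..n. ln (f (x i))) / n - (\<integral>x. ln (f x) \<partial>?N)\<bar>}"
    have comp [measurable]: "i \<in> {1..n} \<Longrightarrow> (\<lambda>x. x i) \<in> measurable (?PM n) M" for i by simp
    have G: "?G \<in> sets (?PM n)" and B: "?B \<in> sets (?PM n)" by measurable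
    have compN [measurable]: "i \<in> {1..n} \<Longrightarrow> (\<lambda>x. x i) \<in> measurable (?PN n) M" for i
      using measurable_component_singleton[of i "{1..n}" "\<lambda>_. ?N"] by simp
    have B12: "?B1 \<in> sets (?PN n)" "?B2 \<in> sets (?PN n)" by measurable
    have GN: "?G \<in> P.events" using G st by simp
    have "space (?PN n) - ?G \<subseteq> ?B1 \<union> ?B2"
    proof (rule subsetI, rule ccontr)
      fix x assume x: "x \<in> space (?PN n) - ?G" "x \<notin> ?B1 \<union> ?B2"
      have "\<bar>(\<Sum>i=1..n. \<phi> (x i)) / n - (\<integral>x. \<phi> x \<partial>?N)\<bar> < (\<integral>x. \<phi> x \<partial>?N) - c" using x by (auto simp: not_le)
      then have 1: "c < (\<Sum>i=1..n. \<phi> (x i)) / n" by linarith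
      have "\<bar>(\<Sum>i=1..n. ln (f (x i))) / n - (\<integral>x. ln (f x) \<partial>?N)\<bar> < K - (\<integral>x. ln (f x) \<partial>?N)" using x by (auto simp: not_le)
      then have "(\<Sum>i=1..n. ln (f (x i))) / n \<le> K" by linarith
      then have "(\<Sum>i=1..n. ln (f (x i))) \<le> n * K" using elim(3) by (simp add: divide_le_eq mult.commute)
      with 1 x(1) sp show False by auto
    qed
    then have "P.prob (space (?PN n) - ?G) \<le> P.prob (?B1 \<union> ?B2)"
      by (rule P.finite_measure_mono) (rule sets.Un[OF B12])
    also have "\<dots> \<le> P.prob ?B1 + P.prob ?B2" by (rule measure_Un_le[OF B12])
    also have "\<dots> \<le> 1 / 4 + 1 / 4" by (intro add_mono elim)
    finally have half: "1 / 2 \<le> P.prob ?G" using P.prob_compl[OF GN] by simp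
    have "emeasure (?PN n) ?G = emeasure (density (?PM n) (\<lambda>x. \<Prod>i\<in>{1..n}. ennreal (f (x i)))) ?G"
      using PiM_density[of "{1..n}" "\<lambda>x. ennreal (f x)"] ps by simp
    also have "\<dots> = (\<integral>\<^sup>+x. (\<Prod>i\<in>{1..n}. ennreal (f (x i))) * indicator ?G x \<partial>?PM n)"
      using G by (intro emeasure_density) measurable
    also have "\<dots> \<le> (\<integral>\<^sup>+x. ennreal (exp (n * K)) * indicator ?G x \<partial>?PM n)"
    proof (rule nn_integral_mono)
      fix x
      have "(\<Prod>i\<in>{1..n}. f (x i)) \<le> exp (n * K)" if "(\<Sum>i=1..n. ln (f (x i))) \<le> n * K"
      \<comment> \<open>A zero of \<open>f\<close> makes the product vanish, so the default value \<open>ln 0 = 0\<close> does no harm.\<close>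
      proof (cases "\<exists>i\<in>{1..n}. f (x i) = 0")
        case True
        then have "(\<Prod>i\<in>{1..n}. f (x i)) = 0" by (intro prod_zero) auto
        then show ?thesis by (simp only: exp_ge_zero)
      next
        case False
        then have "(\<Prod>i\<in>{1..n}. f (x i)) = exp (\<Sum>i=1..n. ln (f (x i)))"
          using nn by (subst exp_sum) (auto intro!: prod.cong simp: less_le exp_ln)
        then show ?thesis using that by simp
      qed
      then show "(\<Prod>i\<in>{1..n}. ennreal (f (x i))) * indicator ?G x \<le> ennreal (exp (n * K)) * indicator ?G x"
        using nn by (auto simp: indicator_def prod_ennreal intro!: ennreal_leI)
    qed
    also have "\<dots> = ennreal (exp (n * K)) * emeasure (?PM n) ?G"
      using G by (intro nn_integral_cmult_indicator)
    finally have "ennreal (P.prob ?G) \<le> ennreal (exp (n * K) * Q.prob ?G)"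
      unfolding P.emeasure_eq_measure Q.emeasure_eq_measure
      by (simp only: ennreal_mult exp_ge_zero measure_nonneg)
    then have "P.prob ?G \<le> exp (n * K) * Q.prob ?G"
      by (rule ennreal_le_iff[THEN iffD1, rotated]) (simp only: exp_ge_zero measure_nonneg mult_nonneg_nonneg)
    also have "\<dots> \<le> exp (n * K) * Q.prob ?B"
      using B by (intro mult_left_mono Q.finite_measure_mono) auto
    finally have "1 / 2 \<le> exp (n * K) * Q.prob ?B" using half by linarith
    then have "1 / 2 * exp (- real n * K) \<le> exp (n * K) * Q.prob ?B * exp (- real n * K)"
      by (intro mult_right_mono) auto
    also have "\<dots> = Q.prob ?B" by (simp add: exp_minus field_simps)
    finally show ?case .
  qed
qed

section \<open>Deviation functions are transportation functions\<close>

text \<open>A lower bound on \<open>P(T(L\<^sub>n) \<ge> t)\<close> needs this event to be measurable, although \<open>\<Phi>\<close> may be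
  uncountable. The functions in \<open>\<Phi>\<close> being continuous, \<open>T(L\<^sub>n)\<close> is a lower
  semicontinuous function of the sample, and its strict superlevel sets are open in the product space
  \<open>nat \<Rightarrow> 'a\<close>. That space is second countable, so open sets are measurable for the product \<open>\<sigma>\<close>-algebra.\<close>

lemma transport_cost_event:
  fixes \<mu> :: "'a::polish_space measure"
  assumes M: "prob_space M" and X: "\<And>i. i \<ge> 1 \<Longrightarrow> X i \<in> measurable M borel" and n: "n \<ge> 1"
    and cont: "\<And>\<psi> \<phi>. (\<psi>, \<phi>) \<in> \<Phi> \<Longrightarrow> continuous_on UNIV \<phi>"
  shows "{\<omega> \<in> space M. transport_cost \<mu> \<Phi> (empirical_measure (\<lambda>i. X i \<omega>) n) \<ge> ereal t} \<in> sets M"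
proof -
  let ?T = "\<lambda>x. transport_cost \<mu> \<Phi> (empirical_measure x n)"
  have T: "?T x = (SUP (\<psi>, \<phi>)\<in>\<Phi>. ereal ((\<integral>x. \<psi> x \<partial>\<mu>) + (\<Sum>i=1..n. \<phi> (x i)) / n))" for x
    unfolding transport_cost_def
  proof (intro SUP_cong refl)
    fix p assume p: "p \<in> \<Phi>"
    obtain \<psi> \<phi> where "p = (\<psi>, \<phi>)" by (cases p)
    moreover then have "\<phi> \<in> borel_measurable borel" using cont p by (intro borel_measurable_continuous_onI) auto
    ultimately show "(case p of (\<psi>, \<phi>) \<Rightarrow> ereal ((\<integral>x. \<psi> x \<partial>\<mu>) + (\<integral>y. \<phi> y \<partial>empirical_measure x n)))
        = (case p of (\<psi>, \<phi>) \<Rightarrow> ereal ((\<integral>x. \<psi> x \<partial>\<mu>) + (\<Sum>i=1..n. \<phi> (x i)) / n))"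
      by (simp add: integral_empirical_measure(2)[OF n])
  qed
  have op: "open {x. ereal s < ?T x}" for s
  proof -
    have "{x. ereal s < ?T x} = (\<Union>(\<psi>, \<phi>)\<in>\<Phi>. {x. s < (\<integral>x. \<psi> x \<partial>\<mu>) + (\<Sum>i=1..n. \<phi> (x i)) / n})"
      unfolding T less_SUP_iff by (auto simp: case_prod_beta)
    also have "open \<dots>"
    proof (intro open_UN ballI)
      fix p assume p: "p \<in> \<Phi>"
      obtain \<psi> \<phi> where eq: "p = (\<psi>, \<phi>)" by (cases p)
      then have "continuous_on UNIV \<phi>" using cont p by auto
      then have "continuous_on UNIV (\<lambda>x::nat \<Rightarrow> 'a. \<phi> (x i))" for i
        by (intro continuous_on_compose2[where g=\<phi> and f="\<lambda>x::nat \<Rightarrow> 'a. x i"] continuous_on_product_coordinates) auto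
      then have "continuous_on UNIV (\<lambda>x::nat \<Rightarrow> 'a. (\<integral>x. \<psi> x \<partial>\<mu>) + (\<Sum>i=1..n. \<phi> (x i)) / n)"
        using n by (intro continuous_intros) auto
      then have "open {x. s < (\<integral>x. \<psi> x \<partial>\<mu>) + (\<Sum>i=1..n. \<phi> (x i)) / n}"
        by (rule open_Collect_less[OF continuous_on_const])
      then show "open (case p of (\<psi>, \<phi>) \<Rightarrow> {x. s < (\<integral>x. \<psi> x \<partial>\<mu>) + (\<Sum>i=1..n. \<phi> (x i)) / n})" by (simp add: eq)
    qed
    finally show ?thesis .
  qed
  have "{x. ereal t \<le> ?T x} = (\<Inter>k::nat. {x. ereal (t - inverse (real (Suc k))) < ?T x})"
  proof safe
    fix x and k :: nat assume "ereal t \<le> ?T x"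
    moreover have "ereal (t - inverse (real (Suc k))) < ereal t" by simp
    ultimately show "ereal (t - inverse (real (Suc k))) < ?T x" by order
  next
    fix x assume *: "x \<in> (\<Inter>k::nat. {x. ereal (t - inverse (real (Suc k))) < ?T x})"
    have "(\<lambda>k. ereal (t - inverse (real (Suc k)))) \<longlonglongrightarrow> ereal (t - 0)"
      by (intro tendsto_intros LIMSEQ_inverse_real_of_nat)
    then show "ereal t \<le> ?T x"
      using * by (intro LIMSEQ_le_const2[where X="\<lambda>k. ereal (t - inverse (real (Suc k)))"]) (auto intro: less_imp_le)
  qed
  also have "\<dots> \<in> sets borel" by (intro sets.countable_INT) (auto intro: borel_open op)
  finally have S: "{x. ereal t \<le> ?T x} \<in> sets (borel :: (nat \<Rightarrow> 'a) measure)" .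
  \<comment> \<open>Samples are numbered from 1; the coordinate 0 is replaced by a constant to make the whole
    sequence measurable.\<close>
  define Y where "Y \<omega> i = (if i = 0 then undefined else X i \<omega>)" for \<omega> i
  have "Y \<in> measurable M (PiM UNIV (\<lambda>_. borel))"
  proof (rule measurable_PiM_single')
    show "(\<lambda>\<omega>. Y \<omega> i) \<in> measurable M borel" for i
      using X[of i] by (cases "i = 0") (auto simp: Y_def)
  qed auto
  then have Ym: "Y \<in> measurable M borel"
    by (simp add: measurable_cong_sets[OF refl sets_PiM_equal_borel])
  have same: "?T (\<lambda>i. X i \<omega>) = ?T (Y \<omega>)" for \<omega>
    unfolding T by (intro SUP_cong refl) (auto simp: Y_def intro!: sum.cong)
  have "{\<omega> \<in> space M. ereal t \<le> ?T (\<lambda>i. X i \<omega>)} = Y -` {x. ereal t \<le> ?T x} \<inter> space M"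
    by (auto simp: same)
  then show ?thesis using measurable_sets[OF Ym S] by simp
qed

text \<open>Finite entropy makes \<open>ln f\<close> integrable under \<open>\<nu>\<close>, which is what the law of large numbers needs.\<close>

lemma borel_probs_finite_entropy_density:
  fixes \<mu> :: "'a::topological_space measure"
  assumes \<mu>: "\<mu> \<in> borel_probs" and \<nu>: "\<nu> \<in> borel_probs" and fin: "relative_entropy \<nu> \<mu> \<noteq> \<infinity>"
  obtains f where "f \<in> borel_measurable \<mu>" "\<And>x. 0 \<le> f x" "density \<mu> (\<lambda>x. ennreal (f x)) = \<nu>"
    "integrable \<nu> (\<lambda>x. ln (f x))" "relative_entropy \<nu> \<mu> = ereal (\<integral>x. ln (f x) \<partial>\<nu>)"
    "0 \<le> relative_entropy \<nu> \<mu>"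
proof -
  interpret \<mu>: prob_space \<mu> using \<mu> by (simp add: borel_probs_def)
  interpret \<nu>: prob_space \<nu> using \<nu> by (simp add: borel_probs_def)
  have ac: "absolutely_continuous \<mu> \<nu>" using fin by (auto simp: relative_entropy_def split: if_splits)
  have "sets \<nu> = sets \<mu>" using \<mu> \<nu> by (simp add: borel_probs_def)
  from \<mu>.obtain_density[OF \<nu>.prob_space_axioms this ac] obtain f
    where f [measurable]: "f \<in> borel_measurable \<mu>" and nn: "\<And>x. 0 \<le> f x"
      and d: "density \<mu> (\<lambda>x. ennreal (f x)) = \<nu>" by metis
  have "emeasure \<nu> (space \<nu>) = 1" by (rule \<nu>.emeasure_space_1)
  then have one: "(\<integral>\<^sup>+x. ennreal (f x) \<partial>\<mu>) = 1"
    unfolding d[symmetric] by (simp add: emeasure_density cong: nn_integral_cong)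
  have H: "relative_entropy \<nu> \<mu> = enn2ereal (\<integral>\<^sup>+x. ennreal (entropy_integrand (f x)) \<partial>\<mu>)"
    using \<mu>.relative_entropy_density[OF f nn one] d by simp
  then have "(\<integral>\<^sup>+x. ennreal (entropy_integrand (f x)) \<partial>\<mu>) \<noteq> \<infinity>"
    using fin by (auto simp: top_ennreal.rep_eq top_ereal_def)
  then have ki: "integrable \<mu> (\<lambda>x. entropy_integrand (f x))"
    using nn by (intro integrableI_nonneg) (auto simp: entropy_integrand_nonneg less_top)
  have fi: "integrable \<mu> f" using one nn by (intro integrableI_nonneg) auto
  have fI: "integral\<^sup>L \<mu> f = 1" using one fi nn by (subst (asm) nn_integral_eq_integral) auto
  have flnf: "f x * ln (f x) = entropy_integrand (f x) + f x - 1" for x by (simp add: entropy_integrand_def)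
  have i: "integrable \<mu> (\<lambda>x. f x * ln (f x))" unfolding flnf using ki fi by auto
  then have lnf: "integrable \<nu> (\<lambda>x. ln (f x))"
    unfolding d[symmetric] by (subst integrable_density) (auto simp: nn)
  have "(\<integral>x. ln (f x) \<partial>\<nu>) = (\<integral>x. f x * ln (f x) \<partial>\<mu>)"
    unfolding d[symmetric] by (subst integral_density) (auto simp: nn)
  also have "\<dots> = (\<integral>x. entropy_integrand (f x) \<partial>\<mu>)"
    unfolding flnf using ki fi fI by (simp add: \<mu>.prob_space)
  finally have "relative_entropy \<nu> \<mu> = ereal (\<integral>x. ln (f x) \<partial>\<nu>)"
    unfolding H using ki nn
    by (subst nn_integral_eq_integral) (auto simp: entropy_integrand_nonneg enn2ereal_ennreal)
  moreover have "0 \<le> relative_entropy \<nu> \<mu>" unfolding H by simp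
  ultimately show ?thesis using that[OF f nn d lnf] by simp
qed

lemma limsup_log_prob_ge:
  fixes p :: "nat \<Rightarrow> real"
  assumes "\<forall>\<^sub>F n in sequentially. 1 / 2 * exp (- real n * K) \<le> p n"
  shows "ereal (- K) \<le> limsup (\<lambda>n. ereal (1 / real n) * log_prob (p n))"
proof -
  have "(\<lambda>n. ln (1 / 2) / real n - K) \<longlonglongrightarrow> 0 - K"
    by (intro tendsto_intros lim_const_over_n)
  then have "(\<lambda>n. ereal (ln (1 / 2) / real n - K)) \<longlonglongrightarrow> ereal (- K)" by simp
  then have "limsup (\<lambda>n. ereal (ln (1 / 2) / real n - K)) = ereal (- K)"
    by (rule lim_imp_Limsup[OF trivial_limit_sequentially])
  moreover have "limsup (\<lambda>n. ereal (ln (1 / 2) / real n - K)) \<le> limsup (\<lambda>n. ereal (1 / real n) * log_prob (p n))"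
  proof (rule Limsup_mono)
    show "\<forall>\<^sub>F n in sequentially. ereal (ln (1 / 2) / real n - K) \<le> ereal (1 / real n) * log_prob (p n)"
      using assms eventually_ge_at_top[of 1]
    proof eventually_elim
      case (elim n)
      have pos: "0 < 1 / 2 * exp (- real n * K)" by simp
      then have "p n > 0" using elim(1) by linarith
      have "ln (1 / 2) - real n * K = ln (1 / 2 * exp (- real n * K))" by (subst ln_mult) auto
      also have "\<dots> \<le> ln (p n)" using elim(1) pos \<open>p n > 0\<close> by (subst ln_le_cancel_iff) auto
      finally have "(ln (1 / 2) - real n * K) / n \<le> ln (p n) / n" by (intro divide_right_mono) auto
      then have "ln (1 / 2) / real n - K \<le> ln (p n) / n" using elim(2) by (simp add: diff_divide_distrib)
      then show ?case using \<open>p n > 0\<close> by (simp add: log_prob_def)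
    qed
  qed
  ultimately show ?thesis by simp
qed

lemma rate_profile_le_at_left_limit:
  assumes \<alpha>: "rate_profile \<alpha>" and t: "0 < t" and le: "\<And>s. 0 \<le> s \<Longrightarrow> s < t \<Longrightarrow> \<alpha> s \<le> H"
  shows "\<alpha> t \<le> H"
proof -
  have "(\<alpha> \<longlongrightarrow> \<alpha> t) (at_left t)" using \<alpha> t by (auto simp: rate_profile_def continuous_within)
  moreover have "\<forall>\<^sub>F s in at_left t. \<alpha> s \<le> H"
    using eventually_at_left[OF t] le t by (auto intro!: exI[of _ 0])
  ultimately show ?thesis by (intro tendsto_upperbound) auto
qed

text \<open>For \<open>t < T(\<nu>)\<close> some pair in \<open>\<Phi>\<close> certifies the inequality, and the event that the empirical
  measure satisfies it too has probability at least of order \<open>exp (- n H)\<close>, up to an arbitrarily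
  small loss in the exponent. Left continuity of \<open>\<alpha>\<close>, or
  its limit at infinity, extends \<open>\<alpha> t \<le> H\<close> to \<open>T(\<nu>)\<close>. When \<open>T(\<nu>) = 0\<close> no smaller \<open>t\<close> is
  available; there \<open>\<alpha> 0 = 0\<close>, because \<open>T(L\<^sub>n) \<ge> 0\<close> always holds.\<close>

lemma deviation_imp_transportation:
  fixes \<mu> :: "'a::polish_space measure" and X :: "nat \<Rightarrow> 'w \<Rightarrow> 'a"
  assumes mu: "\<mu> \<in> borel_probs"
    and zero: "((\<lambda>x. 0), (\<lambda>x. 0)) \<in> \<Phi>" and \<Phi>F: "\<Phi> \<subseteq> F \<times> F"
    and cont: "\<And>\<psi> \<phi>. (\<psi>, \<phi>) \<in> \<Phi> \<Longrightarrow> continuous_on UNIV \<phi>"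
    and M: "prob_space M"
    and ind: "prob_space.indep_vars M (\<lambda>_. borel) X {1..}"
    and law: "\<And>i. i \<ge> 1 \<Longrightarrow> distr M borel (X i) = \<mu>"
    and \<alpha>: "deviation_function \<mu> \<Phi> M X \<alpha>"
  shows "transportation_function \<mu> F \<Phi> \<alpha>"
proof -
  interpret prob_space M by fact
  interpret \<mu>: prob_space \<mu> using mu by (simp add: borel_probs_def)
  have sets_\<mu>: "sets \<mu> = sets borel" using mu by (simp add: borel_probs_def)
  let ?T = "transport_cost \<mu> \<Phi>"
  let ?p = "\<lambda>t n. measure M {\<omega> \<in> space M. ?T (empirical_measure (\<lambda>i. X i \<omega>) n) \<ge> ereal t}"
  have X: "random_variable borel (X i)" if "i \<ge> 1" for i using ind that by (auto simp: indep_vars_def)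
  have prof: "rate_profile \<alpha>"
    and dev: "\<And>t. 0 \<le> t \<Longrightarrow> limsup (\<lambda>n. ereal (1 / real n) * log_prob (?p t n)) \<le> - \<alpha> t"
    using \<alpha> by (auto simp: deviation_function_def)
  have T_nonneg: "0 \<le> ?T \<nu>" for \<nu>
    unfolding transport_cost_def by (rule SUP_upper2[OF zero]) simp
  have law_n: "distr M (PiM {1..n} (\<lambda>_. \<mu>)) (\<lambda>\<omega>. \<lambda>i\<in>{1..n}. X i \<omega>) = PiM {1..n} (\<lambda>_. \<mu>)" if n: "n \<ge> 1" for n
  proof -
    have "distr M (PiM {1..n} (\<lambda>_. borel)) (\<lambda>\<omega>. \<lambda>i\<in>{1..n}. X i \<omega>) = PiM {1..n} (\<lambda>i. distr M borel (X i))"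
      using indep_vars_iff_distr_eq_PiM'[where I="{1..n}" and M'="\<lambda>_. borel" and X=X] indep_vars_subset[OF ind, of "{1..n}"] X n by auto
    also have "\<dots> = PiM {1..n} (\<lambda>_. \<mu>)" by (intro PiM_cong) (auto simp: law)
    finally show ?thesis
      by (metis (no_types, lifting) distr_cong sets_PiM_cong sets_\<mu>)
  qed
  have "extend_to_infinity \<alpha> (?T \<nu>) \<le> relative_entropy \<nu> \<mu>" if \<nu>: "\<nu> \<in> probs_integrating F" for \<nu>
  proof (cases "relative_entropy \<nu> \<mu> = \<infinity>")
    case False
    have \<nu>b: "\<nu> \<in> borel_probs" using \<nu> by (simp add: probs_integrating_def)
    then interpret \<nu>: prob_space \<nu> by (simp add: borel_probs_def)
    obtain f where f: "f \<in> borel_measurable \<mu>" "\<And>x. 0 \<le> f x" "density \<mu> (\<lambda>x. ennreal (f x)) = \<nu>"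
      "integrable \<nu> (\<lambda>x. ln (f x))" "relative_entropy \<nu> \<mu> = ereal (\<integral>x. ln (f x) \<partial>\<nu>)"
      "0 \<le> relative_entropy \<nu> \<mu>"
      using borel_probs_finite_entropy_density[OF mu \<nu>b False] by metis
    let ?H = "relative_entropy \<nu> \<mu>"
    have zero_le: "\<alpha> 0 \<le> ?H"
    proof -
      have "{\<omega> \<in> space M. ?T (empirical_measure (\<lambda>i. X i \<omega>) n) \<ge> ereal 0} = space M" for n
        using T_nonneg by (auto simp: zero_ereal_def[symmetric])
      then have "?p 0 n = 1" for n by (simp add: prob_space)
      then have "limsup (\<lambda>n. ereal (1 / real n) * log_prob (?p 0 n)) = 0"
        by (simp add: log_prob_def Limsup_const flip: zero_ereal_def)
      then have "0 \<le> - \<alpha> 0" using dev[of 0] by simp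
      then have "\<alpha> 0 \<le> 0" by simp
      then show ?thesis using f(6) by order
    qed
    have below: "\<alpha> t \<le> ?H" if t: "0 \<le> t" "ereal t < ?T \<nu>" for t
    proof -
      obtain \<psi> \<phi> where \<phi>: "(\<psi>, \<phi>) \<in> \<Phi>" "t < (\<integral>x. \<psi> x \<partial>\<mu>) + (\<integral>x. \<phi> x \<partial>\<nu>)"
        using t(2) unfolding transport_cost_def less_SUP_iff by auto
      define c where "c = t - (\<integral>x. \<psi> x \<partial>\<mu>)"
      have c: "c < (\<integral>x. \<phi> x \<partial>\<nu>)" using \<phi>(2) by (simp add: c_def)
      have \<phi>i: "integrable \<nu> \<phi>" using \<nu> \<phi>(1) \<Phi>F by (auto simp: probs_integrating_def)
      have \<phi>m [measurable]: "\<phi> \<in> borel_measurable borel" using cont[OF \<phi>(1)] by (rule borel_measurable_continuous_onI)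
      have bound: "\<alpha> t \<le> ereal K" if K: "(\<integral>x. ln (f x) \<partial>\<nu>) < K" for K
      proof -
        have ev: "\<forall>\<^sub>F n in sequentially. 1 / 2 * exp (- real n * K)
          \<le> measure (PiM {1..n} (\<lambda>_. \<mu>)) {x \<in> space (PiM {1..n} (\<lambda>_. \<mu>)). c < (\<Sum>i=1..n. \<phi> (x i)) / n}"
          using \<mu>.change_of_measure_lower_bound[OF f(1,2), of \<phi> c K] f \<nu>.prob_space_axioms \<phi>i c K by simp
        have "\<forall>\<^sub>F n in sequentially. 1 / 2 * exp (- real n * K) \<le> ?p t n"
          using ev eventually_ge_at_top[of 1]
        proof eventually_elim
          case (elim n)
          let ?P = "PiM {1..n} (\<lambda>_. \<mu>)"
          let ?B = "{x \<in> space ?P. c < (\<Sum>i=1..n. \<phi> (x i)) / n}"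
          have "i \<in> {1..n} \<Longrightarrow> (\<lambda>x. \<phi> (x i)) \<in> borel_measurable ?P" for i
            using \<phi>m by (intro measurable_PiM_component_rev) (simp_all add: measurable_cong_sets[OF sets_\<mu> refl])
          then have B: "?B \<in> sets ?P" by measurable
          have Xm: "(\<lambda>\<omega>. \<lambda>i\<in>{1..n}. X i \<omega>) \<in> measurable M ?P"
            using X measurable_cong_sets[OF refl sets_\<mu>] by (intro measurable_restrict) auto
          have "measure ?P ?B = measure (distr M ?P (\<lambda>\<omega>. \<lambda>i\<in>{1..n}. X i \<omega>)) ?B"
            using law_n[OF elim(2)] by simp
          also have "\<dots> = prob ((\<lambda>\<omega>. \<lambda>i\<in>{1..n}. X i \<omega>) -` ?B \<inter> space M)"
            by (rule measure_distr[OF Xm B])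
          also have "\<dots> \<le> ?p t n"
          proof (rule finite_measure_mono)
            show "{\<omega> \<in> space M. ?T (empirical_measure (\<lambda>i. X i \<omega>) n) \<ge> ereal t} \<in> events"
              by (rule transport_cost_event[OF M X elim(2) cont])
            show "(\<lambda>\<omega>. \<lambda>i\<in>{1..n}. X i \<omega>) -` ?B \<inter> space M
              \<subseteq> {\<omega> \<in> space M. ?T (empirical_measure (\<lambda>i. X i \<omega>) n) \<ge> ereal t}"
            proof safe
              fix \<omega> assume \<omega>: "\<omega> \<in> space M" "c < (\<Sum>i=1..n. \<phi> ((\<lambda>i\<in>{1..n}. X i \<omega>) i)) / n"
              have "ereal t \<le> ereal ((\<integral>x. \<psi> x \<partial>\<mu>) + (\<integral>x. \<phi> x \<partial>empirical_measure (\<lambda>i. X i \<omega>) n))"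
              proof -
                have "(\<Sum>i=1..n. \<phi> ((\<lambda>i\<in>{1..n}. X i \<omega>) i)) = (\<Sum>i=1..n. \<phi> (X i \<omega>))"
                  by (intro sum.cong) auto
                then have "c < (\<integral>x. \<phi> x \<partial>empirical_measure (\<lambda>i. X i \<omega>) n)"
                  using \<omega>(2) unfolding integral_empirical_measure(2)[OF elim(2) \<phi>m] by simp
                then show ?thesis unfolding c_def by simp
              qed
              then show "ereal t \<le> ?T (empirical_measure (\<lambda>i. X i \<omega>) n)"
                unfolding transport_cost_def by (intro SUP_upper2[OF \<phi>(1)]) simp
            qed
          qed
          finally show ?case using elim(1) by simp
        qed
        from order_trans[OF limsup_log_prob_ge[OF this] dev[OF t(1)]]
        show ?thesis by (simp flip: uminus_ereal.simps)
      qed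
      show ?thesis
        unfolding f(5)
      proof (rule dense_ge)
        fix y assume y: "ereal (\<integral>x. ln (f x) \<partial>\<nu>) < y"
        then show "\<alpha> t \<le> y" by (cases y) (auto intro: bound)
      qed
    qed
    show ?thesis
    proof (cases "?T \<nu>")
      case (real r)
      then have r: "0 \<le> r" using T_nonneg[of \<nu>] by simp
      have "\<alpha> r \<le> ?H"
      proof (cases "r = 0")
        case False
        show ?thesis
        proof (rule rate_profile_le_at_left_limit[OF prof])
          show "0 < r" using r False by simp
          show "\<alpha> s \<le> ?H" if "0 \<le> s" "s < r" for s by (rule below) (use that real in simp_all)
        qed
      next
        case True
        then show ?thesis using zero_le by simp
      qed
      then show ?thesis using real by (simp add: extend_to_infinity_def)
    next
      case PInf
      have "\<alpha> s \<le> ?H" if "0 \<le> s" for s by (rule below) (use that PInf in simp_all)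
      then show ?thesis unfolding PInf extend_to_infinity_infinity[OF prof] by (intro SUP_least) simp
    next
      case MInf
      then show ?thesis using T_nonneg[of \<nu>] by simp
    qed
  qed simp
  then show ?thesis using prof by (simp add: transportation_function_def)
qed

section \<open>Equivalence of the two notions\<close>

theorem theorem7p1:
  fixes \<mu> :: "'a::polish_space measure"
    and F :: "('a \<Rightarrow> real) set"
    and \<Phi> :: "(('a \<Rightarrow> real) \<times> ('a \<Rightarrow> real)) set"
    and M :: "'w measure"
    and X :: "nat \<Rightarrow> 'w \<Rightarrow> 'a"
  assumes mu: "\<mu> \<in> borel_probs"
    and F_space: "function_space F"
    and F_measurable: "F \<subseteq> borel_measurable borel"
    and F_exp: "\<And>\<phi>. \<phi> \<in> F \<Longrightarrow> (\<integral>\<^sup>+ x. ennreal (exp (\<phi> x)) \<partial>\<mu>) < \<infinity>"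
    and Phi_zero: "((\<lambda>x. 0), (\<lambda>x. 0)) \<in> \<Phi>"
    and Phi_F: "\<Phi> \<subseteq> F \<times> F"
    and Phi_cont: "\<And>\<psi> \<phi>. (\<psi>, \<phi>) \<in> \<Phi> \<Longrightarrow> continuous_on UNIV \<psi> \<and> continuous_on UNIV \<phi>"
    and M: "prob_space M"
    and X_indep: "prob_space.indep_vars M (\<lambda>_. borel) X {1..}"
    and X_law: "\<And>i. i \<ge> 1 \<Longrightarrow> distr M borel (X i) = \<mu>"
  shows "(\<forall>\<alpha>. deviation_function \<mu> \<Phi> M X \<alpha> \<longrightarrow> transportation_function \<mu> F \<Phi> \<alpha>)
       \<and> (continuous_map (weak_topology_on_probs F) euclidean (transport_cost \<mu> \<Phi>) \<longrightarrow>
           (\<forall>\<alpha>. transportation_function \<mu> F \<Phi> \<alpha> \<longrightarrow> deviation_function \<mu> \<Phi> M X \<alpha>))"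
proof (intro conjI impI allI)
  fix \<alpha> assume "deviation_function \<mu> \<Phi> M X \<alpha>"
  then show "transportation_function \<mu> F \<Phi> \<alpha>"
    using Phi_cont by (intro deviation_imp_transportation[OF mu Phi_zero Phi_F _ M X_indep X_law]) auto
next
  fix \<alpha>
  assume cont: "continuous_map (weak_topology_on_probs F) euclidean (transport_cost \<mu> \<Phi>)"
    and \<alpha>: "transportation_function \<mu> F \<Phi> \<alpha>"
  have "sets \<mu> = sets borel" using mu by (simp add: borel_probs_def)
  then have "all_exponential_moments \<mu> g" if "g \<in> F" for g
    using function_space_exponential_moments[OF F_space F_measurable _ F_exp that] by blast
  then show "deviation_function \<mu> \<Phi> M X \<alpha>"
    by (rule transportation_imp_deviation[OF mu F_space F_measurable _ M X_indep X_law cont \<alpha>])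
qed

end
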